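(* Let $C$ be an $n\times n$ real symmetric positive-semidefinite matrix with greatest eigenvalue $\lambda_{\max}$, let $0<s<n$ be an integer with $\operatorname{rank}(C)\ge s$, let $C=\Phi\Lambda\Phi^\top$ be a real Schur decomposition, and let $A:=\Phi(I_n-\frac1{\lambda_{\max}}\Lambda)^{1/2}$, $B:=\frac{1}{\sqrt{\lambda_{\max}}}\Lambda^{1/2}$, so $\text{D-Opt}(A,B,n-s)=\mathcal{D}(\mathrm{MESP}(C,s);\Phi)$. Let $N:=\{1,\dots,n\}$. 1. Let $i\in N$ with $C_{ii}>0$ and let $s\ge2$. Let $\text{D-Opt}(A_1,B_1,n-s):=\mathcal{D}(\mathrm{MESP}(C/C_{ii},s-1);\tilde\Phi)$, where $\tilde\Phi\tilde\Lambda\tilde\Phi^\top$ is a real Schur decomposition of $C/C_{ii}$. Then $$\mathfrak{z}_{\mathcal N}(A_1,B_1,n-s)+(s-1)\log\lambda_1(C/C_{ii})+\log(C_{ii})\ \le\ \mathfrak{z}_{\mathcal N}(A_{(N\setminus i)\cdot},B,n-s)+s\log\lambda_{\max}.$$ 2. Let $j\in N$, with $s\le n-2$ and $\operatorname{rank}(C_{N\setminus j,N\setminus j})\ge s$. Let $\text{D-Opt}(A_0,B_0,n-1-s):=\mathcal{D}(\mathrm{MESP}(C_{N\setminus j,N\setminus j},s);\tilde\Phi)$, where $\tilde\Phi\tilde\Lambda\tilde\Phi^\top$ is a real Schur decomposition of $C_{N\setminus j,N\setminus j}$. Then $$\mathfrak{z}_{\mathcal N}(A_0,B_0,n-1-s)+s\log\lambda_1(C_{N\setminus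 j,N\setminus j})\ \le\ \mathfrak{z}_{\mathcal N}\left(A_{(N\setminus j)\cdot},\begin{pmatrix} A_{j\cdot} \\ B \end{pmatrix},n-s-1\right)+s\log\lambda_{\max}.$$
   Context: $\lambda_1(X)$ denotes the greatest eigenvalue of a symmetric matrix $X$. $A_{(N\setminus i)\cdot}$ is $A$ with row $i$ deleted, $A_{j\cdot}$ is row $j$ of $A$, $C_{N\setminus j,N\setminus j}$ is $C$ with row and column $j$ deleted. $C/C_{ii}:=C_{N\setminus i,N\setminus i}-C_{N\setminus i,i}C_{ii}^{-1}C_{i,N\setminus i}$ is the Schur complement. $\operatorname{ldet}$ is the natural logarithm of the determinant, with value $-\infty$ on singular positive-semidefinite matrices. $\mathrm{MESP}(C,s)$, for $C$ an $n\times n$ positive-semidefinite matrix, $0<s<n$, $\operatorname{rank}(C)\ge s$, is the problem of maximizing $\operatorname{ldet}(C_{S,S})$ over $S\subset N$, $|S|=s$. $\text{D-Opt}(A,B,t)$ is the problem of maximizing $\operatorname{ldet}(A_{T\cdot}^\top A_{T\cdot}+B^\top B)$ over row-index sets $T$ with $|T|=t$. A real Schur decomposition of a symmetric matrix is $\Phi\Lambda\Phi^\top$ with $\Phi$ orthogonal and $\Lambda$ diagonal. For a $k\times k$ positive-semidefinite $C\neq0$ with real Schur decomposition $\Phi\Lambda\Phi^\top$, the map $\mathcal{D}$ is $\mathcal{D}(\mathrm{MESP}(C,s);\Phi):=\text{D-Opt}(A,B,k-s)$ with $A:=\Phi(I_k-\frac{1}{\lambda_1(C)}\Lambda)^{1/2}$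 and $B:=\frac{1}{\sqrt{\lambda_1(C)}}\Lambda^{1/2}$. Natural bound: for $A$ with $k$ rows, $\mathfrak{z}_{\mathcal N}(A,B,t):=\max\{\operatorname{ldet}(A^\top\operatorname{Diag}(x)A+B^\top B):\ \mathbf{e}^\top x=t,\ x\in[0,1]^k\}$, with $\mathbf{e}$ the all-ones vector. *)

theory Defs
  imports
    "Jordan_Normal_Form.DL_Rank"
    "Jordan_Normal_Form.DL_Submatrix"
    "Jordan_Normal_Form.Spectral_Radius"
    "HOL-Analysis.Function_Topology"
    "HOL-Library.Extended_Real"
begin

text \<open>Row and column indices of an \<open>n \<times> n\<close> matrix are \<open>0, \<dots>, n - 1\<close>.\<close>

definition psd :: "nat \<Rightarrow> real mat \<Rightarrow> bool" where
  "psd n M \<longleftrightarrow> M \<in> carrier_mat n n \<and> transpose_mat M = M \<and>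
     (\<forall>v \<in> carrier_vec n. v \<bullet> (M *\<^sub>v v) \<ge> 0)"

definition lambda_max :: "real mat \<Rightarrow> real" where
  "lambda_max M = Max (spectrum M)"

text \<open>The argument is always meant to be positive semidefinite, so that a nonpositive
  determinant means a singular matrix.\<close>

definition ldet :: "real mat \<Rightarrow> ereal" where
  "ldet M = (if det M > 0 then ereal (ln (det M)) else - \<infinity>)"

definition schur_compl :: "real mat \<Rightarrow> nat \<Rightarrow> real mat" where
  "schur_compl C i = submatrix C (- {i}) (- {i}) -
     submatrix C (- {i}) {i} * (inverse (C $$ (i, i)) \<cdot>\<^sub>m submatrix C {i} (- {i}))"

text \<open>The predicate \<open>orthogonal_mat\<close> of the library only asks for pairwise orthogonal
  columns, not for orthonormal ones.\<close>

definition real_schur :: "nat \<Rightarrow> real mat \<Rightarrow> real mat \<Rightarrow> real mat \<Rightarrow> bool" where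
  "real_schur n C \<Phi> \<Lambda> \<longleftrightarrow>
     \<Phi> \<in> carrier_mat n n \<and> transpose_mat \<Phi> * \<Phi> = 1\<^sub>m n \<and> \<Phi> * transpose_mat \<Phi> = 1\<^sub>m n \<and>
     \<Lambda> \<in> carrier_mat n n \<and> diagonal_mat \<Lambda> \<and> C = \<Phi> * \<Lambda> * transpose_mat \<Phi>"

text \<open>For a diagonal matrix with nonnegative entries the positive-semidefinite square root
  is the entrywise one (see \<open>diag_sqrt_square\<close>).\<close>

definition diag_sqrt :: "real mat \<Rightarrow> real mat" where
  "diag_sqrt M = map_mat sqrt M"

lemma diag_sqrt_square:
  assumes M: "M \<in> carrier_mat n n" and diag: "diagonal_mat M"
    and nonneg: "\<And>i. i < n \<Longrightarrow> M $$ (i, i) \<ge> 0"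
  shows "diag_sqrt M * diag_sqrt M = M"
proof (rule eq_matI)
  fix i j assume "i < dim_row M" "j < dim_col M"
  with M have i: "i < n" and j: "j < n" by auto
  have off: "M $$ (a, b) = 0" if "a < n" "b < n" "a \<noteq> b" for a b
    using diag M that by (auto simp: diagonal_mat_def)
  have "(diag_sqrt M * diag_sqrt M) $$ (i, j) =
      (\<Sum>k = 0..<n. sqrt (M $$ (i, k)) * sqrt (M $$ (k, j)))"
    using M i j by (auto simp: diag_sqrt_def scalar_prod_def intro!: sum.cong)
  also have "\<dots> = (\<Sum>k = 0..<n. if k = i then sqrt (M $$ (i, i)) * sqrt (M $$ (i, j)) else 0)"
    using i off by (intro sum.cong) auto
  also have "\<dots> = sqrt (M $$ (i, i)) * sqrt (M $$ (i, j))"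
    using i by simp
  also have "\<dots> = M $$ (i, j)"
    using off[OF i j] nonneg[OF i] by (cases "i = j") auto
  finally show "(diag_sqrt M * diag_sqrt M) $$ (i, j) = M $$ (i, j)" .
qed (use M in \<open>auto simp: diag_sqrt_def\<close>)

text \<open>An instance of an optimization problem is its list of data; the optimal values are given
  by \<open>mesp_value\<close> and \<open>dopt_value\<close>.\<close>

datatype mesp = MESP "real mat" nat

datatype dopt = DOpt "real mat" "real mat" nat

fun mesp_valid :: "nat \<Rightarrow> mesp \<Rightarrow> bool" where
  "mesp_valid n (MESP C s) \<longleftrightarrow> psd n C \<and> 0 < s \<and> s < n \<and> s \<le> vec_space.rank n C"

fun mesp_value :: "mesp \<Rightarrow> ereal" where
  "mesp_value (MESP C s) =
     Max {ldet (submatrix C S S) | S. S \<subseteq> {0..<dim_row C} \<and> card S = s}"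

fun dopt_value :: "dopt \<Rightarrow> ereal" where
  "dopt_value (DOpt A B t) =
     Max {ldet (transpose_mat (submatrix A T UNIV) * submatrix A T UNIV + transpose_mat B * B)
          | T. T \<subseteq> {0..<dim_row A} \<and> card T = t}"

text \<open>The diagonal factor \<open>\<Lambda>\<close>, determined by the matrix and by \<open>\<Phi>\<close>, is passed explicitly.\<close>

fun mesp_to_dopt :: "mesp \<Rightarrow> real mat \<Rightarrow> real mat \<Rightarrow> dopt" where
  "mesp_to_dopt (MESP C s) \<Phi> \<Lambda> =
     DOpt (\<Phi> * diag_sqrt (1\<^sub>m (dim_row C) - (1 / lambda_max C) \<cdot>\<^sub>m \<Lambda>))
          ((1 / sqrt (lambda_max C)) \<cdot>\<^sub>m diag_sqrt \<Lambda>)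
          (dim_row C - s)"

definition nat_feasible :: "nat \<Rightarrow> nat \<Rightarrow> real vec set" where
  "nat_feasible k t =
     {x \<in> carrier_vec k. (\<forall>i < k. 0 \<le> x $ i \<and> x $ i \<le> 1) \<and> (\<Sum>i < k. x $ i) = real t}"

definition nat_objective :: "real mat \<Rightarrow> real mat \<Rightarrow> real vec \<Rightarrow> ereal" where
  "nat_objective A B x =
     ldet (transpose_mat A * mat_diag (dim_row A) (\<lambda>i. x $ i) * A + transpose_mat B * B)"

text \<open>The supremum is a maximum, see \<open>natural_bound_attained\<close>.\<close>

definition natural_bound :: "real mat \<Rightarrow> real mat \<Rightarrow> nat \<Rightarrow> ereal" where
  "natural_bound A B t = (SUP x \<in> nat_feasible (dim_row A) t. nat_objective A B x)"

lemma ldet_mono: "det M \<le> det M' \<Longrightarrow> ldet M \<le> ldet M'"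
  by (auto simp: ldet_def)

lemma natural_bound_attained:
  assumes A: "A \<in> carrier_mat k m" and B: "B \<in> carrier_mat p m" and t: "t \<le> k"
  shows "\<exists>x \<in> nat_feasible k t. natural_bound A B t = nat_objective A B x"
proof -
  define K :: "(nat \<Rightarrow> real) set" where
    "K = PiE UNIV (\<lambda>i. if i < k then {0..1} else {0}) \<inter> {f. (\<Sum>i<k. f i) = real t}"
  define M where "M f = transpose_mat A * mat_diag k f * A + transpose_mat B * B"
    for f :: "nat \<Rightarrow> real"
  have Mc: "M f \<in> carrier_mat m m" for f
    using A B by (auto simp: M_def)
  have entry: "M f $$ (i, j) =
      (\<Sum>l = 0..<k. A $$ (l, i) * f l * A $$ (l, j)) + (transpose_mat B * B) $$ (i, j)"
    if "i < m" "j < m" for f i j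
  proof -
    have "transpose_mat A * mat_diag k f = Matrix.mat m k (\<lambda>(i, l). transpose_mat A $$ (i, l) * f l)"
      by (rule mat_diag_mult_right) (use A in auto)
    then show ?thesis
      using that A B by (auto simp: M_def scalar_prod_def intro!: sum.cong)
  qed
  have "compactin (product_topology (\<lambda>_. euclidean) UNIV)
      (PiE UNIV (\<lambda>i::nat. if i < k then {0..1::real} else {0}))"
    by (subst compactin_PiE) auto
  then have "compact (PiE UNIV (\<lambda>i::nat. if i < k then {0..1::real} else {0}))"
    by (simp add: euclidean_product_topology)
  moreover have "closed {f :: nat \<Rightarrow> real. (\<Sum>i<k. f i) = real t}"
    by (intro closed_Collect_eq continuous_intros continuous_on_product_coordinates)
  ultimately have compK: "compact K"
    unfolding K_def by (rule compact_Int_closed)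
  have "(\<lambda>i. if i < t then 1 else 0) \<in> K"
  proof -
    have "(\<Sum>i<k. if i < t then 1 else (0::real)) = (\<Sum>i<t. 1)"
      using t by (intro sum.mono_neutral_cong_right) auto
    then show ?thesis using t by (auto simp: K_def)
  qed
  then have ne: "K \<noteq> {}" by blast
  have "det (M f) = (\<Sum>\<pi> | \<pi> permutes {0..<m}. signof \<pi> * (\<Prod>i = 0..<m.
      (\<Sum>l = 0..<k. A $$ (l, i) * f l * A $$ (l, \<pi> i)) + (transpose_mat B * B) $$ (i, \<pi> i)))"
    for f
    unfolding det_def'[OF Mc]
    by (intro sum.cong refl arg_cong2[where f = "(*)"] prod.cong entry)
       (auto simp: permutes_def dest: permutes_in_image)
  then have "continuous_on K (\<lambda>f. det (M f))"
    by (simp only:)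
       (intro continuous_intros continuous_on_subset[OF continuous_on_product_coordinates] subset_UNIV)
  from continuous_attains_sup[OF compK ne this]
  obtain g where g: "g \<in> K" and gmax: "\<And>f. f \<in> K \<Longrightarrow> det (M f) \<le> det (M g)"
    by blast
  have obj: "nat_objective A B x = ldet (M (\<lambda>i. if i < k then x $ i else 0))" for x
  proof -
    have "mat_diag k (\<lambda>i. x $ i) = mat_diag k (\<lambda>i. if i < k then x $ i else 0)"
      by (auto simp: mat_diag_def)
    then show ?thesis using A by (simp add: nat_objective_def M_def)
  qed
  have toK: "(\<lambda>i. if i < k then x $ i else 0) \<in> K" if "x \<in> nat_feasible k t" for x
    using that by (auto simp: K_def nat_feasible_def)
  define y where "y = Matrix.vec k g"
  have gK: "(\<And>i. i < k \<Longrightarrow> 0 \<le> g i \<and> g i \<le> 1)" "(\<And>i. \<not> i < k \<Longrightarrow> g i = 0)" "(\<Sum>i<k. g i) = real t"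
    using g by (auto simp: K_def PiE_def Pi_def split: if_splits)
  have y: "y \<in> nat_feasible k t"
    using gK by (auto simp: nat_feasible_def y_def)
  have "(\<lambda>i. if i < k then y $ i else 0) = g"
    using gK(2) by (auto simp: y_def)
  then have yobj: "nat_objective A B y = ldet (M g)"
    by (simp add: obj)
  have "nat_objective A B x \<le> nat_objective A B y" if "x \<in> nat_feasible k t" for x
    unfolding yobj obj[of x] by (intro ldet_mono gmax toK that)
  then have "natural_bound A B t = nat_objective A B y"
    unfolding natural_bound_def using A y
    by (intro antisym SUP_least SUP_upper) auto
  with y show ?thesis by blast
qed

end

theory Submission
  imports Defs
begin

text \<open>
  By Sylvester's determinant identity, the natural objective at \<open>x\<close> is
  \<open>det (Diag x + Diag (1 - x) C / \<lambda>)\<close> with \<open>\<lambda> = \<lambda>\<^sub>1(C)\<close>. More generally consider determinants of matrices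
  with rows \<open>a\<^sub>k e\<^sub>k + b\<^sub>k G\<^sub>k\<close>, where \<open>G\<close> is positive semidefinite and \<open>a, b \<ge> 0\<close>. Expanding in
  row \<open>j\<close> and eliminating with the pivot \<open>G\<^sub>j\<^sub>j\<close> replaces \<open>G\<close> by its Schur complement. This recursion
  shows by induction on the support of \<open>b\<close> that these determinants are nonnegative and monotone
  in \<open>G\<close> for the Loewner order.

  Put \<open>y = 1 - x\<close> and let \<open>\<mu> \<ge> \<lambda> \<ge> G\<^sub>k\<^sub>k\<close> for all \<open>k\<close>. Replacing \<open>y\<^sub>k / \<lambda>\<close> by \<open>y\<^sub>k / \<mu>\<close> in row \<open>k\<close> multiplies
  the determinant by at least \<open>1 - y\<^sub>k + y\<^sub>k \<lambda> / \<mu> \<ge> (\<lambda> / \<mu>) powr y\<^sub>k\<close>. Hence, if the \<open>y\<^sub>k\<close> add up to \<open>s\<close>,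
  \<open>\<lambda> ^ s det (Diag x + Diag y G / \<lambda>)\<close> increases with \<open>\<lambda>\<close>. Both inequalities follow, because
  the greatest eigenvalues of the principal submatrix and of the Schur complement are at most
  \<open>\<lambda>\<^sub>1(C)\<close>.
\<close>

section \<open>Determinants of row pencils\<close>

lemma det_unit_row:
  fixes M :: "real mat"
  assumes M: "M \<in> carrier_mat n n" and i: "i < n"
    and row: "\<And>l. l < n \<Longrightarrow> M $$ (i, l) = (if l = i then c else 0)"
  shows "det M = c * det (mat_delete M i i)"
proof -
  have "det M = (\<Sum>l<n. M $$ (i, l) * cofactor M i l)"
    by (rule laplace_expansion_row[OF M i])
  also have "\<dots> = (\<Sum>l<n. if l = i then c * cofactor M i i else 0)"
    by (intro sum.cong) (auto simp: row)
  also have "\<dots> = c * det (mat_delete M i i)"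
    using i by (simp add: cofactor_def flip: mult_2)
  finally show ?thesis .
qed

lemma det_unit_col:
  fixes M :: "real mat"
  assumes M: "M \<in> carrier_mat n n" and i: "i < n"
    and col: "\<And>l. l < n \<Longrightarrow> M $$ (l, i) = (if l = i then c else 0)"
  shows "det M = c * det (mat_delete M i i)"
proof -
  have "det M = (\<Sum>l<n. M $$ (l, i) * cofactor M l i)"
    by (rule laplace_expansion_column[OF M i])
  also have "\<dots> = (\<Sum>l<n. if l = i then c * cofactor M i i else 0)"
    by (intro sum.cong) (auto simp: col)
  also have "\<dots> = c * det (mat_delete M i i)"
    using i by (simp add: cofactor_def flip: mult_2)
  finally show ?thesis .
qed

text \<open>Cofactors along row \<open>i\<close> do not see that row, so the three matrices share
  them and the expansion is linear. Below, the two summands are \<open>a j\<close> times a unit row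
  and \<open>b j\<close> times row \<open>j\<close> of \<open>G\<close>.\<close>

lemma det_linear_row:
  fixes M M1 M2 :: "real mat"
  assumes M: "M \<in> carrier_mat n n" "M1 \<in> carrier_mat n n" "M2 \<in> carrier_mat n n" and i: "i < n"
    and row: "\<And>l. l < n \<Longrightarrow> M $$ (i, l) = x * M1 $$ (i, l) + y * M2 $$ (i, l)"
    and oth1: "\<And>k l. k < n \<Longrightarrow> k \<noteq> i \<Longrightarrow> l < n \<Longrightarrow> M1 $$ (k, l) = M $$ (k, l)"
    and oth2: "\<And>k l. k < n \<Longrightarrow> k \<noteq> i \<Longrightarrow> l < n \<Longrightarrow> M2 $$ (k, l) = M $$ (k, l)"
  shows "det M = x * det M1 + y * det M2"
proof -
  have "mat_delete M1 i l = mat_delete M i l" "mat_delete M2 i l = mat_delete M i l" if "l < n" for l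
    using M that i by (auto simp: mat_delete_def oth1 oth2 intro!: cong_mat)
  then have del: "cofactor M1 i l = cofactor M i l" "cofactor M2 i l = cofactor M i l" if "l < n" for l
    using that by (simp_all add: cofactor_def)
  have "det M = (\<Sum>l<n. x * (M1 $$ (i, l) * cofactor M1 i l) + y * (M2 $$ (i, l) * cofactor M2 i l))"
    unfolding laplace_expansion_row[OF M(1) i]
    by (intro sum.cong refl) (simp add: del row distrib_right)
  then show ?thesis
    unfolding laplace_expansion_row[OF M(2) i] laplace_expansion_row[OF M(3) i]
    by (simp add: sum_distrib_left sum.distrib)
qed

text \<open>Multiplying \<open>?L\<close> by the unimodular \<open>?R\<close> clears the upper right
  block and leaves \<open>1\<^sub>m n - Q * P\<close> on the diagonal, while the block formula
  evaluates \<open>det ?L\<close> directly as the other determinant.\<close>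

lemma det_one_minus_mult_comm:
  fixes P Q :: "real mat"
  assumes P: "P \<in> carrier_mat n n" and Q: "Q \<in> carrier_mat n n"
  shows "det (1\<^sub>m n - P * Q) = det (1\<^sub>m n - Q * P)"
proof -
  let ?L = "four_block_mat (1\<^sub>m n) P Q (1\<^sub>m n)"
  let ?R = "four_block_mat (1\<^sub>m n) (- P) (0\<^sub>m n n) (1\<^sub>m n)"
  have "?L * ?R = four_block_mat (1\<^sub>m n) (0\<^sub>m n n) Q (1\<^sub>m n - Q * P)"
    using P Q
    by (subst mult_four_block_mat[of _ n n _ n _ n _ _ n _ n])
       (auto intro!: cong_four_block_mat eq_matI)
  moreover have "det (four_block_mat (1\<^sub>m n) (0\<^sub>m n n) Q (1\<^sub>m n - Q * P)) =
      det (1\<^sub>m n) * det (1\<^sub>m n - Q * P)"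
    using P Q by (intro det_four_block_mat_upper_right_zero) auto
  ultimately have "det (?L * ?R) = det (1\<^sub>m n - Q * P)" by simp
  moreover have "det (?L * ?R) = det ?L * det ?R"
    using P Q by (intro det_mult[of _ "n + n"]) auto
  moreover have "det ?L = det (1\<^sub>m n - P * Q)"
    using P Q by (subst det_four_block_mat[of _ n]) auto
  moreover have "det ?R = 1"
    using P by (subst det_four_block_mat_lower_left_zero[of _ n _ n]) auto
  ultimately show ?thesis by simp
qed

text \<open>This is det(Diag(a) + Diag(b) G). Functions instead of matrices make a pivot on one row
  a pair of function updates, and the size stays \<open>n\<close> throughout the inductions.\<close>

definition pencil_det :: "nat \<Rightarrow> (nat \<Rightarrow> real) \<Rightarrow> (nat \<Rightarrow> real) \<Rightarrow> (nat \<Rightarrow> nat \<Rightarrow> real) \<Rightarrow> real" where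
  "pencil_det n a b G =
     det (Matrix.mat n n (\<lambda>(k, l). (if k = l then a k else 0) + b k * G k l))"

text \<open>The Schur complement is kept on all \<open>n\<close> indices: for a nonzero pivot its
  row and column \<open>j\<close> vanish instead of being removed. For a zero pivot, division by
  zero gives 0 and the value is \<open>G\<close> itself.\<close>

definition schur_fun :: "(nat \<Rightarrow> nat \<Rightarrow> real) \<Rightarrow> nat \<Rightarrow> nat \<Rightarrow> nat \<Rightarrow> real" where
  "schur_fun G j k l = G k l - G k j * G j l / G j j"

lemma pencil_det_cong:
  assumes "\<And>k. k < n \<Longrightarrow> a k = a' k"
    and "\<And>k l. k < n \<Longrightarrow> l < n \<Longrightarrow> b k * G k l = b' k * G' k l"
  shows "pencil_det n a b G = pencil_det n a' b' G'"
  unfolding pencil_det_def using assms by (auto intro!: arg_cong[where f = det] eq_matI)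

text \<open>Row \<open>j\<close> has become a unit row, so expanding along it deletes row and column
  \<open>j\<close>. This is the passage from \<open>n\<close> to \<open>n - 1\<close> indices in
  both bounds.\<close>

lemma pencil_det_delete:
  assumes j: "j < n"
  shows "pencil_det n (a(j := 1)) (b(j := 0)) G =
    pencil_det (n - 1) (\<lambda>k. a (insert_index j k)) (\<lambda>k. b (insert_index j k))
      (\<lambda>k l. G (insert_index j k) (insert_index j l))"
  unfolding pencil_det_def
  by (subst det_unit_row[of _ n j 1])
     (use j in \<open>auto intro!: arg_cong[where f = det] eq_matI simp: mat_delete_def insert_index_def\<close>)

text \<open>Linearity in row \<open>j\<close> separates the unit row from row \<open>j\<close> of
  \<open>G\<close>. In the second part one elimination step extracts the pivot \<open>G j j\<close>
  and leaves the Schur complement. By \<open>G0\<close> the pivot row vanishes when the pivot is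
  zero.\<close>

lemma pencil_det_pivot:
  assumes j: "j < n" and G0: "G j j = 0 \<Longrightarrow> \<forall>l<n. G j l = 0"
  shows "pencil_det n a b G = a j * pencil_det n (a(j := 1)) (b(j := 0)) G +
    b j * (G j j * pencil_det n (a(j := 1)) (b(j := 0)) (schur_fun G j))"
proof -
  let ?M = "\<lambda>a b G. Matrix.mat n n (\<lambda>(k, l). (if k = l then a k else 0) + b k * G k l) :: real mat"
  have "pencil_det n a b G = a j * pencil_det n (a(j := 1)) (b(j := 0)) G +
      b j * pencil_det n (a(j := 0)) (b(j := 1)) G"
    unfolding pencil_det_def
    by (rule det_linear_row[of _ n _ _ j]) (use j in auto)
  moreover have "pencil_det n (a(j := 0)) (b(j := 1)) G =
      G j j * pencil_det n (a(j := 1)) (b(j := 0)) (schur_fun G j)"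
  proof (cases "G j j = 0")
    case True
    have "pencil_det n (a(j := 0)) (b(j := 1)) G = 0 * det (mat_delete (?M (a(j := 0)) (b(j := 1)) G) j j)"
      unfolding pencil_det_def by (rule det_unit_row[of _ n]) (use j G0 True in auto)
    then show ?thesis using True by simp
  next
    case False
    let ?W = "?M (a(j := 1)) (b(j := 0)) (schur_fun G j)"
    \<comment> \<open>Elimination as a factorization: \<open>U\<close> is the identity with the
      pivot row of \<open>G\<close> in row \<open>j\<close>, and \<open>N\<close> is
      \<open>?W\<close> with the multipliers \<open>b k * G k j / G j j\<close> put into column
      \<open>j\<close>, where \<open>?W\<close> is zero off the diagonal.\<close>
    define N where "N = Matrix.mat n n (\<lambda>(k, l). if k = j then (if l = j then 1 else 0)
      else ?W $$ (k, l) + (if l = j then b k * G k j / G j j else 0))"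
    define U where "U = Matrix.mat n n (\<lambda>(k, l). if k = j then G j l else if k = l then 1 else 0)"
    have c: "N \<in> carrier_mat n n" "U \<in> carrier_mat n n" by (auto simp: N_def U_def)
    have "?M (a(j := 0)) (b(j := 1)) G = N * U"
    proof (rule eq_matI)
      fix k l assume "k < dim_row (N * U)" "l < dim_col (N * U)"
      then have kl: "k < n" "l < n" using c by auto
      have "(N * U) $$ (k, l) = (\<Sum>m\<in>{0..<n}. N $$ (k, m) * U $$ (m, l))"
        using kl c by (simp add: scalar_prod_def)
      also have "\<dots> = N $$ (k, j) * U $$ (j, l) + (\<Sum>m\<in>{0..<n} - {j}. N $$ (k, m) * U $$ (m, l))"
        using j by (subst sum.remove[of _ j]) auto
      also have "(\<Sum>m\<in>{0..<n} - {j}. N $$ (k, m) * U $$ (m, l)) =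
          (\<Sum>m\<in>{0..<n} - {j}. if m = l then N $$ (k, l) else 0)"
        using kl by (intro sum.cong) (auto simp: U_def)
      also have "\<dots> = (if l = j then 0 else N $$ (k, l))"
        using kl by simp
      finally have e: "(N * U) $$ (k, l) =
        N $$ (k, j) * U $$ (j, l) + (if l = j then 0 else N $$ (k, l))" .
      show "?M (a(j := 0)) (b(j := 1)) G $$ (k, l) = (N * U) $$ (k, l)"
        unfolding e using kl j False by (auto simp: N_def U_def schur_fun_def field_simps)
    qed (use c in auto)
    then have "pencil_det n (a(j := 0)) (b(j := 1)) G = det N * det U"
      using c by (simp add: pencil_det_def det_mult)
    moreover have "det U = G j j"
    proof -
      have "det U = G j j * det (mat_delete U j j)"
        by (rule det_unit_col[OF c(2) j]) (use j in \<open>auto simp: U_def\<close>)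
      also have "mat_delete U j j = 1\<^sub>m (n - 1)"
        using j by (auto intro!: eq_matI simp: mat_delete_def U_def)
      finally show ?thesis by simp
    qed
    moreover have "det N = det ?W"
    proof -
      have "det N = 1 * det (mat_delete N j j)"
        by (rule det_unit_row[OF c(1) j]) (use j in \<open>auto simp: N_def\<close>)
      moreover have "det ?W = 1 * det (mat_delete ?W j j)"
        by (rule det_unit_row[of _ n]) (use j in auto)
      moreover have "mat_delete N j j = mat_delete ?W j j"
        using j by (auto intro!: eq_matI simp: mat_delete_def N_def)
      ultimately show ?thesis by simp
    qed
    ultimately show ?thesis by (simp add: pencil_det_def)
  qed
  ultimately show ?thesis by simp
qed

section \<open>Quadratic forms, Schur complements and the Loewner order\<close>

definition quad_form :: "nat \<Rightarrow> (nat \<Rightarrow> nat \<Rightarrow> real) \<Rightarrow> (nat \<Rightarrow> real) \<Rightarrow> real" where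
  "quad_form n G v = (\<Sum>k<n. \<Sum>l<n. v k * G k l * v l)"

definition psd_fun :: "nat \<Rightarrow> (nat \<Rightarrow> nat \<Rightarrow> real) \<Rightarrow> bool" where
  "psd_fun n G \<longleftrightarrow> (\<forall>k<n. \<forall>l<n. G k l = G l k) \<and> (\<forall>v. 0 \<le> quad_form n G v)"

text \<open>A polynomial in the change \<open>t\<close> of one coordinate: for a positive pivot its
  minimum produces the Schur complement, for a zero pivot it is affine and forces row
  \<open>j\<close> to vanish.\<close>

lemma quad_form_shift:
  assumes sym: "\<forall>k<n. \<forall>l<n. G k l = G l k" and j: "j < n"
  shows "quad_form n G (v(j := v j - t)) =
    quad_form n G v - 2 * t * (\<Sum>l<n. G j l * v l) + t\<^sup>2 * G j j"
proof -
  define w where "w k = (if k = j then t else 0)" for k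
  have v: "(v(j := v j - t)) k = v k - w k" for k by (simp add: w_def)
  have q: "quad_form n G v = (\<Sum>k<n. v k * (\<Sum>l<n. G k l * v l))" for v
    by (simp add: quad_form_def sum_distrib_left mult_ac)
  have wr: "(\<Sum>k<n. w k * f k) = t * f j" "(\<Sum>k<n. f k * w k) = t * f j" for f
  proof -
    have "(\<Sum>k<n. w k * f k) = (\<Sum>k<n. if k = j then t * f j else 0)"
      by (intro sum.cong) (auto simp: w_def)
    then show "(\<Sum>k<n. w k * f k) = t * f j" using j by simp
    then show "(\<Sum>k<n. f k * w k) = t * f j" by (simp add: mult.commute)
  qed
  have in1: "(\<Sum>l<n. G k l * (v l - w l)) = (\<Sum>l<n. G k l * v l) - t * G k j" for k
    by (simp add: right_diff_distrib sum_subtractf wr)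
  have sy: "(\<Sum>k<n. v k * G k j) = (\<Sum>l<n. G j l * v l)"
    using sym j by (intro sum.cong) auto
  have "quad_form n G (v(j := v j - t)) =
      (\<Sum>k<n. (v k - w k) * ((\<Sum>l<n. G k l * v l) - t * G k j))"
    unfolding q v by (simp add: in1)
  also have "\<dots> = (\<Sum>k<n. v k * (\<Sum>l<n. G k l * v l)) - t * (\<Sum>k<n. v k * G k j)
      - (\<Sum>k<n. w k * ((\<Sum>l<n. G k l * v l) - t * G k j))"
    by (simp add: algebra_simps sum_subtractf sum.distrib sum_distrib_left)
  also have "\<dots> = quad_form n G v - 2 * t * (\<Sum>l<n. G j l * v l) + t\<^sup>2 * G j j"
    unfolding wr sy by (simp add: q algebra_simps power2_eq_square)
  finally show ?thesis .
qed

text \<open>By symmetry the subtracted rank-one term is the square of a linear form. A zero pivot is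
  covered: division by it gives 0 on both sides.\<close>

lemma quad_form_schur:
  assumes sym: "\<forall>k<n. \<forall>l<n. G k l = G l k" and j: "j < n"
  shows "quad_form n (schur_fun G j) v = quad_form n G v - (\<Sum>l<n. G j l * v l)\<^sup>2 / G j j"
proof -
  have "(\<Sum>l<n. G j l * v l)\<^sup>2 / G j j = (\<Sum>k<n. v k * G k j) * (\<Sum>l<n. G j l * v l) / G j j"
    using sym j by (auto simp: power2_eq_square mult.commute intro!: arg_cong2[where f = "(/)"] arg_cong2[where f = "(*)"] sum.cong)
  also have "\<dots> = (\<Sum>k<n. \<Sum>l<n. v k * (G k j * G j l / G j j) * v l)"
    by (simp add: sum_product sum_divide_distrib mult_ac)
  finally show ?thesis
    by (simp add: quad_form_def schur_fun_def algebra_simps sum_subtractf)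
qed

text \<open>Complete the square in \<open>t\<close>. Together with the next lemma: the form of the
  Schur complement is the minimum of the form of \<open>G\<close> over all changes of coordinate
  \<open>j\<close>.\<close>

lemma quad_form_schur_le_shift:
  assumes psd: "psd_fun n G" and j: "j < n" and pos: "G j j > 0"
  shows "quad_form n (schur_fun G j) v \<le> quad_form n G (v(j := v j - t))"
proof -
  have sym: "\<forall>k<n. \<forall>l<n. G k l = G l k" using psd by (simp add: psd_fun_def)
  define r where "r = (\<Sum>l<n. G j l * v l)"
  have "0 \<le> (t * G j j - r)\<^sup>2 / G j j" using pos by simp
  also have "\<dots> = t\<^sup>2 * G j j - 2 * t * r + r\<^sup>2 / G j j"
    using pos by (simp add: power2_eq_square field_simps)
  finally show ?thesis
    unfolding quad_form_shift[OF sym j] quad_form_schur[OF sym j] r_def[symmetric] by simp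
qed

lemma quad_form_schur_attained:
  assumes psd: "psd_fun n G" and j: "j < n" and pos: "G j j > 0"
  shows "\<exists>t. quad_form n (schur_fun G j) v = quad_form n G (v(j := v j - t))"
proof -
  have sym: "\<forall>k<n. \<forall>l<n. G k l = G l k" using psd by (simp add: psd_fun_def)
  show ?thesis
    unfolding quad_form_shift[OF sym j] quad_form_schur[OF sym j]
    using pos by (intro exI[of _ "(\<Sum>l<n. G j l * v l) / G j j"]) (simp add: power2_eq_square field_simps)
qed

lemma quad_form_indicator:
  assumes "j < n"
  shows "quad_form n G (\<lambda>k. if k = j then 1 else 0) = G j j"
proof -
  have "quad_form n G (\<lambda>k. if k = j then 1 else 0) =
      (\<Sum>k<n. \<Sum>l<n. if l = j then (if k = j then G j j else 0) else 0)"
    unfolding quad_form_def by (intro sum.cong refl) auto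
  then show ?thesis using assms by simp
qed

lemma psd_fun_diag_nonneg: "psd_fun n G \<Longrightarrow> j < n \<Longrightarrow> 0 \<le> G j j"
  using quad_form_indicator[of j n G] by (metis psd_fun_def)

text \<open>Shift the unit vector of \<open>l\<close> in coordinate \<open>j\<close>. With a zero
  pivot the form is affine in the shift, and \<open>?t\<close> is chosen to give it the value
  -1.\<close>

lemma psd_fun_zero_row:
  assumes psd: "psd_fun n G" and j: "j < n" and l: "l < n" and z: "G j j = 0"
  shows "G j l = 0"
proof (rule ccontr)
  assume nz: "G j l \<noteq> 0"
  let ?e = "\<lambda>k. if k = l then 1 else 0 :: real"
  let ?t = "(G l l + 1) / (2 * G j l)"
  have sym: "\<forall>k<n. \<forall>l<n. G k l = G l k" using psd by (simp add: psd_fun_def)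
  have "(\<Sum>m<n. G j m * ?e m) = (\<Sum>m<n. if m = l then G j l else 0)"
    by (intro sum.cong) auto
  then have s: "(\<Sum>m<n. G j m * ?e m) = G j l" using l by simp
  have "0 \<le> quad_form n G (?e(j := ?e j - ?t))" using psd by (simp add: psd_fun_def)
  also have "\<dots> = G l l - 2 * ?t * G j l"
    unfolding quad_form_shift[OF sym j, of ?e ?t] s quad_form_indicator[OF l] z by simp
  also have "\<dots> = - 1" using nz by (simp add: field_simps)
  finally show False by simp
qed

lemma psd_fun_schur:
  assumes psd: "psd_fun n G" and j: "j < n"
  shows "psd_fun n (schur_fun G j)"
proof -
  have sym: "\<forall>k<n. \<forall>l<n. G k l = G l k" using psd by (simp add: psd_fun_def)
  have "0 \<le> quad_form n (schur_fun G j) v" for v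
  proof (cases "G j j = 0")
    case True
    then show ?thesis using psd by (simp add: psd_fun_def schur_fun_def[abs_def])
  next
    case False
    then have "G j j > 0" using psd_fun_diag_nonneg[OF psd j] by simp
    then show ?thesis
      using quad_form_schur_attained[OF psd j, of v] psd by (auto simp: psd_fun_def)
  qed
  then show ?thesis using sym j by (auto simp: psd_fun_def schur_fun_def)
qed

lemma quad_form_schur_le:
  assumes psd: "psd_fun n G" and j: "j < n"
  shows "quad_form n (schur_fun G j) v \<le> quad_form n G v"
  unfolding quad_form_schur[OF psd[unfolded psd_fun_def, THEN conjunct1] j]
  using psd_fun_diag_nonneg[OF psd j] by simp

text \<open>Minima of ordered forms are ordered: the minimizing shift for \<open>G\<close> is used
  as a competitor for \<open>G'\<close>. The positive pivot of \<open>G'\<close> makes that of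
  \<open>G\<close> positive.\<close>

lemma quad_form_schur_mono:
  assumes psd: "psd_fun n G" "psd_fun n G'" and le: "\<And>v. quad_form n G' v \<le> quad_form n G v"
    and j: "j < n" and pos: "G' j j > 0"
  shows "quad_form n (schur_fun G' j) v \<le> quad_form n (schur_fun G j) v"
proof -
  have "G' j j \<le> G j j"
    using le[of "\<lambda>k. if k = j then 1 else 0"] j by (simp add: quad_form_indicator)
  with pos have "G j j > 0" by simp
  from quad_form_schur_attained[OF psd(1) j this, of v] obtain t where
    "quad_form n (schur_fun G j) v = quad_form n G (v(j := v j - t))" by blast
  then show ?thesis
    using quad_form_schur_le_shift[OF psd(2) j pos, of v t] le[of "v(j := v j - t)"] by simp
qed

section \<open>Nonnegativity and monotonicity of pencil determinants\<close>

lemma pencil_det_diag: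
  assumes "\<And>k. k < n \<Longrightarrow> b k = 0"
  shows "pencil_det n a b G = (\<Prod>k<n. a k)"
proof -
  have "pencil_det n a b G = det (Matrix.mat n n (\<lambda>(k, l). if k = l then a k else 0))"
    unfolding pencil_det_def using assms by (auto intro!: arg_cong[where f = det] eq_matI)
  also have "\<dots> = (\<Prod>k<n. a k)"
    by (subst det_upper_triangular[of _ n])
       (auto simp: prod_list_diag_prod atLeast0LessThan)
  finally show ?thesis .
qed

text \<open>\<open>T\<close> contains the support of \<open>b\<close>. Pivoting on \<open>j\<close>
  sets \<open>b j\<close> to 0 in both terms, which carry nonnegative weights, but it changes
  \<open>a\<close> and \<open>G\<close> too; hence the induction is general in all three.\<close>

lemma pencil_det_nonneg_aux:
  assumes "finite T" "T \<subseteq> {..<n}"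
  shows "psd_fun n G \<Longrightarrow> (\<And>k. k < n \<Longrightarrow> 0 \<le> a k) \<Longrightarrow> (\<And>k. k < n \<Longrightarrow> 0 \<le> b k) \<Longrightarrow>
    (\<And>k. k < n \<Longrightarrow> k \<notin> T \<Longrightarrow> b k = 0) \<Longrightarrow> 0 \<le> pencil_det n a b G"
  using assms
proof (induction T arbitrary: a b G rule: finite_induct)
  case empty
  then show ?case by (auto simp: pencil_det_diag intro!: prod_nonneg)
next
  case (insert j T)
  then have j: "j < n" by auto
  have "0 \<le> pencil_det n (a(j := 1)) (b(j := 0)) H" if "psd_fun n H" for H
    by (rule insert.IH[OF that]) (use insert.prems in auto)
  from this[OF insert.prems(1)] this[OF psd_fun_schur[OF insert.prems(1) j]] show ?case
    by (subst pencil_det_pivot[of j])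
       (use j insert.prems psd_fun_zero_row[OF insert.prems(1) j]
          psd_fun_diag_nonneg[OF insert.prems(1) j] in auto)
qed

lemma pencil_det_nonneg:
  assumes "psd_fun n G" "\<And>k. k < n \<Longrightarrow> 0 \<le> a k" "\<And>k. k < n \<Longrightarrow> 0 \<le> b k"
  shows "0 \<le> pencil_det n a b G"
  by (rule pencil_det_nonneg_aux[of "{..<n}"]) (use assms in auto)

text \<open>Both determinants are pivoted on the same row and compared term by term. The term with
  the pivot is a product of two nonnegative factors, each monotone in the matrix.\<close>

lemma pencil_det_mono_aux:
  assumes "finite T" "T \<subseteq> {..<n}"
  shows "psd_fun n G \<Longrightarrow> psd_fun n G' \<Longrightarrow> (\<And>v. quad_form n G' v \<le> quad_form n G v) \<Longrightarrow>
    (\<And>k. k < n \<Longrightarrow> 0 \<le> a k) \<Longrightarrow> (\<And>k. k < n \<Longrightarrow> 0 \<le> b k) \<Longrightarrow>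
    (\<And>k. k < n \<Longrightarrow> k \<notin> T \<Longrightarrow> b k = 0) \<Longrightarrow> pencil_det n a b G' \<le> pencil_det n a b G"
  using assms
proof (induction T arbitrary: a b G G' rule: finite_induct)
  case empty
  then show ?case by (simp add: pencil_det_diag)
next
  case (insert j T)
  note psd = insert.prems(1) and psd' = insert.prems(2)
  from insert have j: "j < n" by auto
  let ?D = "pencil_det n (a(j := 1)) (b(j := 0))"
  have IH: "?D H' \<le> ?D H"
    if "psd_fun n H" "psd_fun n H'" "\<And>v. quad_form n H' v \<le> quad_form n H v" for H H'
    by (rule insert.IH[OF that]) (use insert.prems in auto)
  have nn: "0 \<le> ?D H" if "psd_fun n H" for H
    by (rule pencil_det_nonneg[OF that]) (use insert.prems in auto)
  have dle: "G' j j \<le> G j j"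
    using insert.prems(3)[of "\<lambda>k. if k = j then 1 else 0"] j by (simp add: quad_form_indicator)
  have d0: "0 \<le> G' j j" by (rule psd_fun_diag_nonneg[OF psd' j])
  have "G' j j * ?D (schur_fun G' j) \<le> G j j * ?D (schur_fun G j)"
  proof (cases "G' j j = 0")
    \<comment> \<open>Here the left side is 0. The comparison of Schur complements is available only
      for a positive pivot of \<open>G'\<close>.\<close>
    case True
    then show ?thesis using dle nn[OF psd_fun_schur[OF psd j]] by simp
  next
    case False
    with d0 have pos: "G' j j > 0" by simp
    have "?D (schur_fun G' j) \<le> ?D (schur_fun G j)"
      by (intro IH psd_fun_schur psd psd' j quad_form_schur_mono insert.prems(3) pos)
    then show ?thesis
      using dle d0 nn[OF psd_fun_schur[OF psd' j]] by (intro mult_mono) auto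
  qed
  moreover have "?D G' \<le> ?D G" by (rule IH[OF psd psd' insert.prems(3)])
  moreover have "pencil_det n a b H = a j * ?D H + b j * (H j j * ?D (schur_fun H j))"
    if "psd_fun n H" for H
    using psd_fun_zero_row[OF that j] by (intro pencil_det_pivot[OF j]) auto
  ultimately show ?case
    using psd psd' insert.prems(4,5)[OF j] by (simp add: add_mono mult_left_mono)
qed

lemma pencil_det_mono:
  assumes "psd_fun n G" "psd_fun n G'" "\<And>v. quad_form n G' v \<le> quad_form n G v"
    "\<And>k. k < n \<Longrightarrow> 0 \<le> a k" "\<And>k. k < n \<Longrightarrow> 0 \<le> b k"
  shows "pencil_det n a b G' \<le> pencil_det n a b G"
  by (rule pencil_det_mono_aux[of "{..<n}"]) (use assms in auto)

section \<open>Dependence on the scaling parameter\<close>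

lemma pencil_det_rescale_coord:
  assumes psd: "psd_fun n G" and j: "j < n" and lam: "0 < lam" "lam \<le> mu" and d: "G j j \<le> lam"
    and y: "0 \<le> y" "y \<le> 1" and ab: "\<And>k. k < n \<Longrightarrow> 0 \<le> a k" "\<And>k. k < n \<Longrightarrow> 0 \<le> b k"
    and aj: "a j = 1 - y" "b j = y / lam"
  shows "(1 - y + y * (lam / mu)) * pencil_det n a b G \<le> pencil_det n a (b(j := y / mu)) G"
proof -
  define r where "r = lam / mu"
  have r: "r \<le> 1" using lam by (simp add: r_def)
  let ?D = "pencil_det n (a(j := 1)) (b(j := 0))"
  \<comment> \<open>\<open>E\<close> is the determinant with row \<open>j\<close> replaced by row
    \<open>j\<close> of \<open>G\<close> divided by \<open>lam\<close>, so the two determinants to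
    compare are combinations of \<open>?D G\<close> and \<open>E\<close>. Since \<open>G j j\<close>
    is at most \<open>lam\<close> and the Schur complement lies below \<open>G\<close>,
    \<open>E\<close> is at most \<open>?D G\<close>.\<close>
  define E where "E = G j j * ?D (schur_fun G j) / lam"
  have p: "pencil_det n a c G = a j * ?D G + c j * (lam * E)" if "c(j := 0) = b(j := 0)" for c
    using pencil_det_pivot[OF j, of G a c] psd_fun_zero_row[OF psd j] that lam
    by (simp add: E_def)
  have "0 \<le> ?D (schur_fun G j)"
    by (rule pencil_det_nonneg[OF psd_fun_schur[OF psd j]]) (use ab in auto)
  moreover have "?D (schur_fun G j) \<le> ?D G"
    by (rule pencil_det_mono[OF psd psd_fun_schur[OF psd j] quad_form_schur_le[OF psd j]])
       (use ab in auto)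
  moreover have "E \<le> ?D (schur_fun G j)"
    unfolding E_def using lam d calculation(1)
    by (simp add: divide_le_eq mult.commute[of _ lam] mult_right_mono)
  ultimately have "E \<le> ?D G" by simp
  \<comment> \<open>This product is exactly the difference of the two sides of the claim.\<close>
  then have "0 \<le> y * (1 - y) * (1 - r) * (?D G - E)" using y r by simp
  moreover have p1: "pencil_det n a b G = (1 - y) * ?D G + y * E" using p[of b] aj lam by simp
  moreover have p2: "pencil_det n a (b(j := y / mu)) G = (1 - y) * ?D G + y * r * E"
    using p[of "b(j := y / mu)"] aj(1) by (simp add: r_def)
  ultimately show ?thesis unfolding r_def[symmetric] p1 p2 by (simp add: algebra_simps)
qed

text \<open>Weighted arithmetic-geometric mean inequality for \<open>r\<close> and 1. Dividing both
  by their mean \<open>m\<close> before applying ln t \<le> t - 1 makes the upper bounds add up to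
  0.\<close>

lemma powr_le_weighted_mean:
  fixes r y :: real
  assumes r: "0 < r" "r \<le> 1" and y: "0 \<le> y" "y \<le> 1"
  shows "r powr y \<le> 1 - y + y * r"
proof -
  define m where "m = 1 - y + y * r"
  have m: "m > 0"
  proof (cases "y = 1")
    case False
    then show ?thesis using r y by (auto simp: m_def intro!: add_pos_nonneg)
  qed (use r in \<open>simp add: m_def\<close>)
  have "y * ln (r / m) + (1 - y) * ln (1 / m) \<le> y * (r / m - 1) + (1 - y) * (1 / m - 1)"
    using r m y by (intro add_mono mult_left_mono ln_le_minus_one) auto
  also have "\<dots> = (1 - y + y * r) / m - 1" using m by (simp add: field_simps)
  also have "\<dots> = 0" using m by (simp add: m_def)
  finally have "y * ln r \<le> ln m" using r m by (simp add: ln_div algebra_simps)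
  then have "exp (y * ln r) \<le> exp (ln m)" by simp
  also have "exp (ln m) = m" using m by simp
  finally show ?thesis using r by (simp add: powr_def m_def)
qed

text \<open>Rows are rescaled one at a time, and \<open>?P T\<close> is the determinant after the
  rows in \<open>T\<close>. Row \<open>k\<close> costs a factor of at least
  \<open>r powr y k\<close>, and the exponents add up to \<open>s\<close>.\<close>

lemma pencil_det_scaled_mono:
  assumes psd: "psd_fun n G" and lam: "0 < lam" "lam \<le> mu" and d: "\<And>k. k < n \<Longrightarrow> G k k \<le> lam"
    and y: "\<And>k. k < n \<Longrightarrow> 0 \<le> y k" "\<And>k. k < n \<Longrightarrow> y k \<le> 1" and sum: "(\<Sum>k<n. y k) = real s"
  shows "lam ^ s * pencil_det n (\<lambda>k. 1 - y k) (\<lambda>k. y k / lam) G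
    \<le> mu ^ s * pencil_det n (\<lambda>k. 1 - y k) (\<lambda>k. y k / mu) G"
proof -
  define r where "r = lam / mu"
  have mu: "mu > 0" using lam by simp
  have r: "0 < r" "r \<le> 1" using lam by (auto simp: r_def)
  let ?P = "\<lambda>T. pencil_det n (\<lambda>k. 1 - y k) (\<lambda>k. if k \<in> T then y k / mu else y k / lam) G"
  have w: "0 \<le> 1 - y k + y k * r" if "k < n" for k using y[OF that] r by simp
  have nn: "0 \<le> ?P {}"
    by (rule pencil_det_nonneg[OF psd]) (use y lam in auto)
  have "(\<Prod>k\<in>T. 1 - y k + y k * r) * ?P {} \<le> ?P T" if "T \<subseteq> {..<n}" "finite T" for T
    using that(2,1)
  proof (induction T rule: finite_induct)
    case (insert j T)
    then have j: "j < n" by auto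
    have "(1 - y j + y j * (lam / mu)) * ?P T
      \<le> pencil_det n (\<lambda>k. 1 - y k) ((\<lambda>k. if k \<in> T then y k / mu else y k / lam)(j := y j / mu)) G"
      by (rule pencil_det_rescale_coord[OF psd j lam d[OF j] y[OF j]])
         (use y lam mu insert.hyps in auto)
    also have "((\<lambda>k. if k \<in> T then y k / mu else y k / lam)(j := y j / mu)) =
        (\<lambda>k. if k \<in> insert j T then y k / mu else y k / lam)" by auto
    finally have "(1 - y j + y j * r) * ?P T \<le> ?P (insert j T)" by (simp add: r_def)
    moreover have "(1 - y j + y j * r) * ((\<Prod>k\<in>T. 1 - y k + y k * r) * ?P {}) \<le> (1 - y j + y j * r) * ?P T"
      using insert w[OF j] by (intro mult_left_mono) auto
    ultimately show ?case using insert.hyps by (simp add: mult.assoc)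
  qed simp
  from this[of "{..<n}"] have "(\<Prod>k<n. 1 - y k + y k * r) * ?P {} \<le> ?P {..<n}" by simp
  moreover have "r ^ s = (\<Prod>k<n. r powr y k)"
    using r sum by (simp add: powr_realpow flip: powr_sum)
  moreover have "\<dots> \<le> (\<Prod>k<n. 1 - y k + y k * r)"
    using y r by (intro prod_mono) (auto intro!: powr_le_weighted_mean)
  ultimately have "r ^ s * ?P {} \<le> ?P {..<n}"
    using mult_right_mono[OF _ nn, of "r ^ s" "\<Prod>k<n. 1 - y k + y k * r"] by linarith
  then have "mu ^ s * (r ^ s * ?P {}) \<le> mu ^ s * ?P {..<n}"
    using mu by simp
  moreover have "mu ^ s * r ^ s = lam ^ s" using mu by (simp add: r_def power_divide)
  moreover have "?P {..<n} = pencil_det n (\<lambda>k. 1 - y k) (\<lambda>k. y k / mu) G"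
    by (rule pencil_det_cong) auto
  ultimately show ?thesis by (simp flip: mult.assoc)
qed

section \<open>The natural objective and the greatest eigenvalue\<close>

lemma gram_diag_entry:
  fixes A :: "real mat"
  assumes A: "A \<in> carrier_mat n m" and "p < m" "q < m"
  shows "(transpose_mat A * mat_diag n x * A) $$ (p, q) = (\<Sum>l<n. A $$ (l, p) * x l * A $$ (l, q))"
  by (subst mat_diag_mult_right[of _ m]) (use assms in \<open>auto simp: scalar_prod_def atLeast0LessThan\<close>)

lemma diag_sqrt_symmetric:
  assumes M: "M \<in> carrier_mat n n" and diag: "diagonal_mat M"
  shows "transpose_mat (diag_sqrt M) = diag_sqrt M"
proof (rule eq_matI)
  fix i j assume "i < dim_row (diag_sqrt M)" "j < dim_col (diag_sqrt M)"
  then show "transpose_mat (diag_sqrt M) $$ (i, j) = diag_sqrt M $$ (i, j)"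
    using M diag by (cases "i = j") (auto simp: diag_sqrt_def diagonal_mat_def)
qed (use M in \<open>auto simp: diag_sqrt_def\<close>)

text \<open>The factors satisfy A^T A + B^T B = I and A A^T = I - C / lam. So the matrix is I - A^T
  Diag(1 - x) A, and Sylvester's identity moves A^T to the right end, next to A. The bounds on
  \<open>\<Lambda>\<close> keep both square roots on nonnegative diagonals.\<close>

lemma det_gram_eq_pencil_det:
  fixes A B :: "real mat"
  assumes rs: "real_schur n C \<Phi> \<Lambda>" and lam: "0 < lam"
    and ev: "\<And>k. k < n \<Longrightarrow> 0 \<le> \<Lambda> $$ (k, k)" "\<And>k. k < n \<Longrightarrow> \<Lambda> $$ (k, k) \<le> lam"
    and A: "A = \<Phi> * diag_sqrt (1\<^sub>m n - (1 / lam) \<cdot>\<^sub>m \<Lambda>)"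
    and B: "B = (1 / sqrt lam) \<cdot>\<^sub>m diag_sqrt \<Lambda>"
  shows "det (transpose_mat A * mat_diag n x * A + transpose_mat B * B) =
    pencil_det n x (\<lambda>k. (1 - x k) / lam) (\<lambda>k l. C $$ (k, l))"
proof -
  define D where "D = 1\<^sub>m n - (1 / lam) \<cdot>\<^sub>m \<Lambda>"
  define E where "E = diag_sqrt D"
  define S where "S = diag_sqrt \<Lambda>"
  have \<Phi>: "\<Phi> \<in> carrier_mat n n" "transpose_mat \<Phi> * \<Phi> = 1\<^sub>m n" "\<Phi> * transpose_mat \<Phi> = 1\<^sub>m n"
    and \<Lambda>: "\<Lambda> \<in> carrier_mat n n" "diagonal_mat \<Lambda>" and C: "C = \<Phi> * \<Lambda> * transpose_mat \<Phi>"
    using rs by (auto simp: real_schur_def)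
  have off: "\<Lambda> $$ (k, l) = 0" if "k < n" "l < n" "k \<noteq> l" for k l
    using \<Lambda> that by (auto simp: diagonal_mat_def)
  have Dc: "D \<in> carrier_mat n n" unfolding D_def using \<Lambda>(1) by (intro minus_carrier_mat smult_carrier_mat)
  have Ec: "E \<in> carrier_mat n n" "S \<in> carrier_mat n n"
    using Dc \<Lambda> by (auto simp: E_def S_def diag_sqrt_def)
  have Ac: "A \<in> carrier_mat n n" "B \<in> carrier_mat n n"
    using Ec \<Phi> by (auto simp: A B E_def[unfolded D_def] S_def)
  have EE: "E * E = D"
    unfolding E_def
    by (rule diag_sqrt_square[OF Dc]) (use \<Lambda> ev lam off Dc in \<open>auto simp: D_def diagonal_mat_def\<close>)
  have SS: "S * S = \<Lambda>"
    unfolding S_def by (rule diag_sqrt_square[OF \<Lambda> ev(1)])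
  have Et: "transpose_mat E = E"
    unfolding E_def
    by (rule diag_sqrt_symmetric[OF Dc]) (use \<Lambda> off in \<open>auto simp: D_def diagonal_mat_def\<close>)
  have St: "transpose_mat S = S"
    unfolding S_def by (rule diag_sqrt_symmetric[OF \<Lambda>])
  have AE: "A = \<Phi> * E" by (simp add: A E_def D_def)
  have At: "transpose_mat A = E * transpose_mat \<Phi>"
    using \<Phi> Ec by (simp add: AE transpose_mult Et)
  have AtA: "transpose_mat A * A = D"
  proof -
    have "transpose_mat A * A = E * (transpose_mat \<Phi> * \<Phi>) * E"
      unfolding At unfolding AE using \<Phi>(1) Ec by (simp add: assoc_mult_mat[of _ n n _ n _ n])
    then show ?thesis using \<Phi> Ec by (simp add: EE)
  qed
  have AAt: "A * transpose_mat A = 1\<^sub>m n - (1 / lam) \<cdot>\<^sub>m C"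
  proof -
    have "A * transpose_mat A = \<Phi> * (E * E) * transpose_mat \<Phi>"
      unfolding At unfolding AE using \<Phi>(1) Ec by (simp add: assoc_mult_mat[of _ n n _ n _ n])
    also have "\<Phi> * (E * E) = \<Phi> - (1 / lam) \<cdot>\<^sub>m (\<Phi> * \<Lambda>)"
      unfolding EE D_def using \<Phi>(1) \<Lambda>(1)
      by (subst mult_minus_distrib_mat[of _ n n _ n]) (auto simp: mult_smult_distrib[of _ n n])
    also have "\<dots> * transpose_mat \<Phi> = \<Phi> * transpose_mat \<Phi> - (1 / lam) \<cdot>\<^sub>m C"
      unfolding C using \<Phi>(1) \<Lambda>(1)
      by (subst minus_mult_distrib_mat[of _ n n _ _ n])
        (auto simp: mult_smult_assoc_mat[of _ n n _ n] simp del: assoc_mult_mat)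
    finally show ?thesis by (simp add: \<Phi>)
  qed
  have BtB: "transpose_mat B * B = (1 / lam) \<cdot>\<^sub>m \<Lambda>"
  proof -
    have Bt: "transpose_mat B = (1 / sqrt lam) \<cdot>\<^sub>m S"
      unfolding B S_def[symmetric] by (subst (2) St[symmetric]) (use Ec in \<open>auto intro!: eq_matI\<close>)
    have "transpose_mat B * B = ((1 / sqrt lam) * (1 / sqrt lam)) \<cdot>\<^sub>m (S * S)"
      unfolding Bt unfolding B S_def[symmetric] using Ec
      by (auto intro!: eq_matI simp: mult_smult_distrib[of _ n n _ n] mult_smult_assoc_mat[of _ n n _ n])
    then show ?thesis using lam SS by (simp add: real_sqrt_mult_self)
  qed
  let ?Y = "mat_diag n (\<lambda>k. 1 - x k) :: real mat"
  have "transpose_mat A * mat_diag n x * A + transpose_mat B * B = 1\<^sub>m n - transpose_mat A * (?Y * A)"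
  proof (rule eq_matI)
    fix p q assume "p < dim_row (1\<^sub>m n - transpose_mat A * (?Y * A))" "q < dim_col (1\<^sub>m n - transpose_mat A * (?Y * A))"
    then have pq: "p < n" "q < n" using Ac by auto
    have "(\<Sum>l<n. A $$ (l, p) * A $$ (l, q)) = (transpose_mat A * A) $$ (p, q)"
      using Ac pq by (simp add: scalar_prod_def atLeast0LessThan)
    also have "\<dots> = 1\<^sub>m n $$ (p, q) - (transpose_mat B * B) $$ (p, q)"
      using pq \<Lambda> by (simp add: AtA BtB D_def)
    finally have s: "(transpose_mat B * B) $$ (p, q) = 1\<^sub>m n $$ (p, q) - (\<Sum>l<n. A $$ (l, p) * A $$ (l, q))"
      by simp
    have "transpose_mat A * (?Y * A) = transpose_mat A * ?Y * A"
      using Ac by (simp add: assoc_mult_mat[of _ n n _ n _ n])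
    then have "(1\<^sub>m n - transpose_mat A * (?Y * A)) $$ (p, q) =
        1\<^sub>m n $$ (p, q) - (\<Sum>l<n. A $$ (l, p) * (1 - x l) * A $$ (l, q))"
      using gram_diag_entry[OF Ac(1) pq, of "\<lambda>k. 1 - x k"] pq Ac by simp
    moreover have "(transpose_mat A * mat_diag n x * A + transpose_mat B * B) $$ (p, q) =
        (\<Sum>l<n. A $$ (l, p) * x l * A $$ (l, q)) + (transpose_mat B * B) $$ (p, q)"
      using gram_diag_entry[OF Ac(1) pq, of x] pq Ac by simp
    ultimately show "(transpose_mat A * mat_diag n x * A + transpose_mat B * B) $$ (p, q) =
      (1\<^sub>m n - transpose_mat A * (?Y * A)) $$ (p, q)"
      unfolding s by (simp add: algebra_simps sum_subtractf)
  qed (use Ac in auto)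
  moreover have "det (1\<^sub>m n - transpose_mat A * (?Y * A)) = det (1\<^sub>m n - ?Y * A * transpose_mat A)"
    by (rule det_one_minus_mult_comm) (use Ac in \<open>auto intro!: mult_carrier_mat[of _ n n]\<close>)
  moreover have "1\<^sub>m n - ?Y * A * transpose_mat A =
      Matrix.mat n n (\<lambda>(k, l). (if k = l then x k else 0) + (1 - x k) / lam * C $$ (k, l))"
  proof -
    have "?Y * A * transpose_mat A = ?Y * (1\<^sub>m n - (1 / lam) \<cdot>\<^sub>m C)"
      using Ac AAt by (simp add: assoc_mult_mat[of _ n n _ n _ n])
    also have "\<dots> = Matrix.mat n n (\<lambda>(k, l). (1 - x k) * (1\<^sub>m n - (1 / lam) \<cdot>\<^sub>m C) $$ (k, l))"
      by (rule mat_diag_mult_left) (use C \<Phi> \<Lambda> in auto)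
    finally show ?thesis
      using C \<Phi> \<Lambda> by (auto intro!: eq_matI simp: algebra_simps diff_divide_distrib)
  qed
  ultimately show ?thesis by (simp add: pencil_det_def)
qed

lemma quad_form_vec:
  assumes "C \<in> carrier_mat n n" "v \<in> carrier_vec n"
  shows "quad_form n (\<lambda>k l. C $$ (k, l)) (\<lambda>k. v $ k) = v \<bullet> (C *\<^sub>v v)"
  using assms
  by (simp add: quad_form_def scalar_prod_def atLeast0LessThan sum_distrib_left mult.assoc)

lemma psd_imp_psd_fun:
  assumes "psd n C"
  shows "psd_fun n (\<lambda>k l. C $$ (k, l))"
  unfolding psd_fun_def
proof (intro conjI allI impI)
  fix k l assume "k < n" "l < n"
  then show "C $$ (k, l) = C $$ (l, k)"
    using assms by (metis carrier_matD index_transpose_mat(1) psd_def)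
next
  fix v :: "nat \<Rightarrow> real"
  have "quad_form n (\<lambda>k l. C $$ (k, l)) v = quad_form n (\<lambda>k l. C $$ (k, l)) (\<lambda>k. Matrix.vec n v $ k)"
    by (simp add: quad_form_def)
  also have "\<dots> \<ge> 0"
    using assms by (subst quad_form_vec) (auto simp: psd_def)
  finally show "0 \<le> quad_form n (\<lambda>k l. C $$ (k, l)) v" .
qed

text \<open>Used with the eigenvalues as \<open>d\<close> for \<open>C\<close> and with
  \<open>d\<close> equal to 1 for the identity matrix, which expresses the form and the norm in the
  same coordinates.\<close>

lemma quad_form_diagonalized:
  assumes "\<And>k l. k < n \<Longrightarrow> l < n \<Longrightarrow> G k l = (\<Sum>m<n. F k m * d m * F l m)"
  shows "quad_form n G v = (\<Sum>m<n. d m * (\<Sum>k<n. F k m * v k)\<^sup>2)"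
proof -
  have "quad_form n G v = (\<Sum>k<n. \<Sum>l<n. \<Sum>m<n. d m * ((F k m * v k) * (F l m * v l)))"
    unfolding quad_form_def
    by (intro sum.cong refl) (simp add: assms sum_distrib_left sum_distrib_right mult_ac)
  also have "\<dots> = (\<Sum>m<n. \<Sum>k<n. \<Sum>l<n. d m * ((F k m * v k) * (F l m * v l)))"
    by (rule trans[OF sum.cong[OF refl sum.swap] sum.swap])
  also have "\<dots> = (\<Sum>m<n. d m * (\<Sum>k<n. F k m * v k)\<^sup>2)"
    by (simp only: power2_eq_square sum_product) (simp add: sum_distrib_left)
  finally show ?thesis .
qed

section \<open>Spectral facts read off a Schur decomposition\<close>

context
  fixes n :: nat and C \<Phi> \<Lambda> :: "real mat"
  assumes rs: "real_schur n C \<Phi> \<Lambda>"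
begin

lemma real_schur_carrier:
  "\<Phi> \<in> carrier_mat n n" "\<Lambda> \<in> carrier_mat n n" "C \<in> carrier_mat n n"
  using rs by (auto simp: real_schur_def)

lemma real_schur_off: "k < n \<Longrightarrow> l < n \<Longrightarrow> k \<noteq> l \<Longrightarrow> \<Lambda> $$ (k, l) = 0"
  using rs by (auto simp: real_schur_def diagonal_mat_def)

lemma real_schur_entry:
  assumes kl: "k < n" "l < n"
  shows "C $$ (k, l) = (\<Sum>m<n. \<Phi> $$ (k, m) * \<Lambda> $$ (m, m) * \<Phi> $$ (l, m))"
proof -
  have "(\<Phi> * \<Lambda>) $$ (k, m) = \<Phi> $$ (k, m) * \<Lambda> $$ (m, m)" if "m < n" for m
  proof -
    have "(\<Phi> * \<Lambda>) $$ (k, m) = (\<Sum>j<n. \<Phi> $$ (k, j) * \<Lambda> $$ (j, m))"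
      using kl that real_schur_carrier by (simp add: scalar_prod_def atLeast0LessThan)
    also have "\<dots> = (\<Sum>j<n. if j = m then \<Phi> $$ (k, m) * \<Lambda> $$ (m, m) else 0)"
      using that by (intro sum.cong) (auto simp: real_schur_off)
    finally show ?thesis using that by simp
  qed
  moreover have "C $$ (k, l) = (\<Sum>m<n. (\<Phi> * \<Lambda>) $$ (k, m) * \<Phi> $$ (l, m))"
    using rs kl real_schur_carrier
    by (simp add: real_schur_def scalar_prod_def atLeast0LessThan del: assoc_mult_mat)
  ultimately show ?thesis by simp
qed

lemma real_schur_orthonormal:
  assumes "k < n" "l < n"
  shows "(\<Sum>m<n. \<Phi> $$ (k, m) * \<Phi> $$ (l, m)) = (if k = l then 1 else 0)"
    and "(\<Sum>m<n. \<Phi> $$ (m, k) * \<Phi> $$ (m, l)) = (if k = l then 1 else 0)"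
proof -
  have "(\<Phi> * transpose_mat \<Phi>) $$ (k, l) = 1\<^sub>m n $$ (k, l)"
    "(transpose_mat \<Phi> * \<Phi>) $$ (k, l) = 1\<^sub>m n $$ (k, l)"
    using rs by (auto simp: real_schur_def)
  then show "(\<Sum>m<n. \<Phi> $$ (k, m) * \<Phi> $$ (l, m)) = (if k = l then 1 else 0)"
    and "(\<Sum>m<n. \<Phi> $$ (m, k) * \<Phi> $$ (m, l)) = (if k = l then 1 else 0)"
    using assms real_schur_carrier by (auto simp: scalar_prod_def atLeast0LessThan)
qed

lemma real_schur_quad_form:
  "quad_form n (\<lambda>k l. C $$ (k, l)) v = (\<Sum>m<n. \<Lambda> $$ (m, m) * (\<Sum>k<n. \<Phi> $$ (k, m) * v k)\<^sup>2)"
  by (rule quad_form_diagonalized) (rule real_schur_entry)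

lemma real_schur_norm:
  "(\<Sum>k<n. (v k)\<^sup>2) = (\<Sum>m<n. (\<Sum>k<n. \<Phi> $$ (k, m) * v k)\<^sup>2)"
proof -
  have "quad_form n (\<lambda>k l. if k = l then 1 else 0) v = (\<Sum>m<n. 1 * (\<Sum>k<n. \<Phi> $$ (k, m) * v k)\<^sup>2)"
    by (rule quad_form_diagonalized) (simp add: real_schur_orthonormal)
  moreover have "quad_form n (\<lambda>k l. if k = l then 1 else 0) v =
      (\<Sum>k<n. \<Sum>l<n. if l = k then (v k)\<^sup>2 else 0)"
    unfolding quad_form_def by (intro sum.cong refl) (auto simp: power2_eq_square)
  ultimately show ?thesis by simp
qed

lemma real_schur_diag_eq:
  assumes m: "m < n"
  shows "quad_form n (\<lambda>k l. C $$ (k, l)) (\<lambda>k. \<Phi> $$ (k, m)) = \<Lambda> $$ (m, m)"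
proof -
  have "quad_form n (\<lambda>k l. C $$ (k, l)) (\<lambda>k. \<Phi> $$ (k, m)) =
      (\<Sum>j<n. if j = m then \<Lambda> $$ (m, m) else 0)"
    unfolding real_schur_quad_form using m
    by (intro sum.cong) (auto simp: real_schur_orthonormal)
  then show ?thesis using m by simp
qed

lemma real_schur_diag_nonneg:
  "psd_fun n (\<lambda>k l. C $$ (k, l)) \<Longrightarrow> m < n \<Longrightarrow> 0 \<le> \<Lambda> $$ (m, m)"
  using real_schur_diag_eq by (metis psd_fun_def)

text \<open>Orthogonality turns the decomposition into
  \<open>C * \<Phi> = \<Phi> * \<Lambda>\<close>, so column \<open>m\<close> of
  \<open>\<Phi>\<close> is an eigenvector; it has norm 1 and hence is nonzero.\<close>

lemma real_schur_eigenvalue: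
  assumes m: "m < n"
  shows "\<Lambda> $$ (m, m) \<in> spectrum C"
proof -
  have \<Phi>: "transpose_mat \<Phi> * \<Phi> = 1\<^sub>m n" "C = \<Phi> * \<Lambda> * transpose_mat \<Phi>"
    using rs by (auto simp: real_schur_def)
  note c = real_schur_carrier
  have C\<Phi>: "C * \<Phi> = \<Phi> * \<Lambda>"
    unfolding \<Phi>(2) using c(1,2) \<Phi>(1) by (simp add: assoc_mult_mat[of _ n n _ n _ n])
  have "C *\<^sub>v col \<Phi> m = \<Lambda> $$ (m, m) \<cdot>\<^sub>v col \<Phi> m"
  proof (rule eq_vecI)
    fix k assume "k < dim_vec (\<Lambda> $$ (m, m) \<cdot>\<^sub>v col \<Phi> m)"
    then have k: "k < n" using c by simp
    have "(C *\<^sub>v col \<Phi> m) $ k = (C * \<Phi>) $$ (k, m)" using k m c by simp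
    also have "\<dots> = (\<Sum>j<n. \<Phi> $$ (k, j) * \<Lambda> $$ (j, m))"
      using k m c unfolding C\<Phi> by (simp add: scalar_prod_def atLeast0LessThan)
    also have "\<dots> = (\<Sum>j<n. if j = m then \<Phi> $$ (k, m) * \<Lambda> $$ (m, m) else 0)"
      using m by (intro sum.cong) (auto simp: real_schur_off)
    finally show "(C *\<^sub>v col \<Phi> m) $ k = (\<Lambda> $$ (m, m) \<cdot>\<^sub>v col \<Phi> m) $ k"
      using k m c by simp
  qed (use c in auto)
  moreover have "col \<Phi> m \<noteq> 0\<^sub>v n"
  proof
    assume z: "col \<Phi> m = 0\<^sub>v n"
    have "\<Phi> $$ (k, m) = 0" if "k < n" for k
      using arg_cong[OF z, of "\<lambda>v. v $ k"] that m c by simp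
    then show False using real_schur_orthonormal(2)[OF m m] by simp
  qed
  ultimately have "eigenvector C (col \<Phi> m) (\<Lambda> $$ (m, m))"
    using c by (auto simp: eigenvector_def)
  then show ?thesis by (auto simp: spectrum_def eigenvalue_def)
qed

lemma real_schur_diag_le: "m < n \<Longrightarrow> \<Lambda> $$ (m, m) \<le> lambda_max C"
  unfolding lambda_max_def
  using card_finite_spectrum(1)[OF real_schur_carrier(3)] real_schur_eigenvalue by (intro Max_ge) auto

lemma quad_form_le_lambda_max:
  "quad_form n (\<lambda>k l. C $$ (k, l)) v \<le> lambda_max C * (\<Sum>k<n. (v k)\<^sup>2)"
  unfolding real_schur_quad_form[of v] real_schur_norm[of v] sum_distrib_left
  by (intro sum_mono mult_right_mono) (auto simp: real_schur_diag_le)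

text \<open>Evaluate the assumed bound at an eigenvector for \<open>lambda_max C\<close>. By
  \<open>0 < n\<close> the spectrum is nonempty, so \<open>Max\<close> is one of its
  elements.\<close>

lemma lambda_max_le:
  assumes n: "0 < n" and le: "\<And>v. quad_form n (\<lambda>k l. C $$ (k, l)) v \<le> \<mu> * (\<Sum>k<n. (v k)\<^sup>2)"
  shows "lambda_max C \<le> \<mu>"
proof -
  have "lambda_max C \<in> spectrum C"
    unfolding lambda_max_def using card_finite_spectrum(1)[OF real_schur_carrier(3)]
      real_schur_eigenvalue[OF n] by (intro Max_in) auto
  then obtain v where v: "v \<in> carrier_vec n" "v \<noteq> 0\<^sub>v n" "C *\<^sub>v v = lambda_max C \<cdot>\<^sub>v v"
    using real_schur_carrier(3) by (auto simp: spectrum_def eigenvalue_def eigenvector_def)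
  have vv: "v \<bullet> v = (\<Sum>k<n. (v $ k)\<^sup>2)"
    using v(1) by (simp add: scalar_prod_def atLeast0LessThan power2_eq_square)
  obtain k where k: "k < n" "v $ k \<noteq> 0"
    using v(1,2) by (metis carrier_vecD eq_vecI index_zero_vec)
  then have "0 < (\<Sum>k<n. (v $ k)\<^sup>2)"
    by (intro sum_pos2[of _ k]) auto
  moreover have "quad_form n (\<lambda>k l. C $$ (k, l)) (\<lambda>k. v $ k) = lambda_max C * (\<Sum>k<n. (v $ k)\<^sup>2)"
    unfolding quad_form_vec[OF real_schur_carrier(3) v(1)] v(3) vv[symmetric] using v(1) by simp
  ultimately show ?thesis using le[of "\<lambda>k. v $ k"] by simp
qed

lemma diag_le_lambda_max:
  assumes "k < n"
  shows "C $$ (k, k) \<le> lambda_max C"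
proof -
  have "(\<Sum>j<n. (if j = k then 1 else 0 :: real)\<^sup>2) = (\<Sum>j<n. if j = k then 1 else 0)"
    by (intro sum.cong) auto
  then show ?thesis
    using quad_form_le_lambda_max[of "\<lambda>j. if j = k then 1 else 0"] assms
    by (simp add: quad_form_indicator)
qed

text \<open>The diagonal of \<open>\<Lambda>\<close> lies between 0 and \<open>lambda_max C\<close>;
  if the latter is not positive, the diagonal vanishes, and every entry of \<open>C\<close> with
  it.\<close>

lemma lambda_max_pos:
  assumes psd: "psd_fun n (\<lambda>k l. C $$ (k, l))" and n: "0 < n" and nz: "C \<noteq> 0\<^sub>m n n"
  shows "0 < lambda_max C"
proof (rule ccontr)
  assume "\<not> 0 < lambda_max C"
  then have "\<Lambda> $$ (m, m) = 0" if "m < n" for m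
    using real_schur_diag_le[OF that] real_schur_diag_nonneg[OF psd that] by simp
  then have "C = 0\<^sub>m n n"
    using real_schur_carrier(3) by (auto intro!: eq_matI simp: real_schur_entry)
  then show False using nz by simp
qed

end

section \<open>Deleting an index\<close>

lemma sum_insert_index:
  fixes f :: "nat \<Rightarrow> real"
  assumes i: "i < n"
  shows "(\<Sum>k<n. f k) = f i + (\<Sum>k<n - 1. f (insert_index i k))"
proof -
  have "insert_index i ` {..<n - 1} = {..<n} - {i}"
    using insert_index_image[of i "n - 1"] i by (simp add: atLeast0LessThan)
  moreover have "(\<Sum>k<n - 1. f (insert_index i k)) = sum f (insert_index i ` {..<n - 1})"
    by (rule sum.reindex_cong[symmetric, OF insert_index_inj_on]) auto
  ultimately show ?thesis using i by (simp add: sum.remove[of _ i])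
qed

lemma insert_index_less: "k < n - 1 \<Longrightarrow> insert_index i k < n"
  by (auto simp: insert_index_def)

text \<open>Padding vectors by 0 at \<open>i\<close> is how positive semidefiniteness and eigenvalue
  bounds pass to the smaller matrix.\<close>

lemma quad_form_delete:
  assumes i: "i < n"
  shows "quad_form (n - 1) (\<lambda>k l. G (insert_index i k) (insert_index i l)) v =
    quad_form n G (\<lambda>k. if k = i then 0 else v (delete_index i k))"
  unfolding quad_form_def sum_insert_index[OF i] by simp

lemma psd_fun_delete:
  assumes psd: "psd_fun n G" and i: "i < n"
  shows "psd_fun (n - 1) (\<lambda>k l. G (insert_index i k) (insert_index i l))"
  unfolding psd_fun_def quad_form_delete[OF i]
  using psd insert_index_less[of _ n i] by (auto simp: psd_fun_def simp del: One_nat_def)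

lemma quad_form_cong:
  "(\<And>k l. k < n \<Longrightarrow> l < n \<Longrightarrow> G k l = H k l) \<Longrightarrow> quad_form n G v = quad_form n H v"
  unfolding quad_form_def by (intro sum.cong refl) auto

lemma psd_fun_cong:
  assumes "\<And>k l. k < n \<Longrightarrow> l < n \<Longrightarrow> G k l = H k l"
  shows "psd_fun n G \<longleftrightarrow> psd_fun n H"
  using quad_form_cong[of n G H, OF assms] assms by (auto simp: psd_fun_def)

lemma sum_squares_delete:
  assumes i: "i < n"
  shows "(\<Sum>k<n. (if k = i then 0 else v (delete_index i k))\<^sup>2) = (\<Sum>k<n - 1. (v k :: real)\<^sup>2)"
  unfolding sum_insert_index[OF i] by simp

section \<open>Submatrices and Gram matrices in coordinates\<close>

lemma pick_Compl: "pick (- {i}) k = insert_index i k"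
proof (induction k)
  case 0
  show ?case by (auto simp: insert_index_def intro!: Least_equality)
next
  case (Suc k)
  then show ?case by (auto simp: insert_index_def intro!: Least_equality)
qed

lemma pick_singleton: "pick {i} 0 = i"
  by (auto intro!: Least_equality)

lemma card_Compl: "i < n \<Longrightarrow> card {k. k < n \<and> k \<in> - {i}} = n - 1"
proof -
  assume i: "i < n"
  have "{k. k < n \<and> k \<in> - {i}} = {..<n} - {i}" by auto
  then show ?thesis using i by simp
qed

lemma card_singleton: "i < n \<Longrightarrow> card {k. k = i \<and> k < n} = Suc 0"
proof -
  assume "i < n"
  then have "{k. k = i \<and> k < n} = {i}" by auto
  then show ?thesis by simp
qed

text \<open>\<open>submatrix\<close> numbers the retained indices by \<open>pick\<close>, which for
  the complement of a point is \<open>insert_index\<close>, the shift used in the pencil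
  lemmas.\<close>

lemma submatrix_delete:
  assumes "C \<in> carrier_mat n n" "i < n"
  shows "submatrix C (- {i}) (- {i}) =
    Matrix.mat (n - 1) (n - 1) (\<lambda>(k, l). C $$ (insert_index i k, insert_index i l))"
  using assms unfolding submatrix_def by (simp add: card_Compl pick_Compl del: Compl_iff)

lemma schur_compl_entries:
  assumes C: "C \<in> carrier_mat n n" and i: "i < n"
  shows "schur_compl C i = Matrix.mat (n - 1) (n - 1)
    (\<lambda>(k, l). schur_fun (\<lambda>k l. C $$ (k, l)) i (insert_index i k) (insert_index i l))"
proof -
  have c: "submatrix C (- {i}) {i} = Matrix.mat (n - 1) 1 (\<lambda>(k, l). C $$ (insert_index i k, i))"
    using C i unfolding submatrix_def
    by (auto intro!: cong_mat simp: card_Compl card_singleton pick_Compl pick_singleton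
        simp del: Compl_iff pick.simps)
  have r: "submatrix C {i} (- {i}) = Matrix.mat 1 (n - 1) (\<lambda>(k, l). C $$ (i, insert_index i l))"
    using C i unfolding submatrix_def
    by (auto intro!: cong_mat simp: card_Compl card_singleton pick_Compl pick_singleton
        simp del: Compl_iff pick.simps)
  show ?thesis
    unfolding schur_compl_def submatrix_delete[OF C i] c r
    by (auto intro!: eq_matI simp: scalar_prod_def schur_fun_def divide_inverse mult_ac)
qed

lemma submatrix_rows:
  assumes "A \<in> carrier_mat n m" "i < n"
  shows "submatrix A (- {i}) UNIV = Matrix.mat (n - 1) m (\<lambda>(k, l). A $$ (insert_index i k, l))"
  using assms unfolding submatrix_def by (simp add: card_Compl pick_Compl pick_UNIV del: Compl_iff)

lemma submatrix_single_row:
  assumes "A \<in> carrier_mat n m" "i < n"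
  shows "submatrix A {i} UNIV = Matrix.mat 1 m (\<lambda>(k, l). A $$ (i, l))"
  using assms unfolding submatrix_def
  by (auto intro!: cong_mat simp: card_singleton pick_singleton pick_UNIV
      simp del: pick.simps)

text \<open>Weight 0 removes the summand of row \<open>i\<close> from the Gram sum, with the same
  effect as deleting the row.\<close>

lemma gram_submatrix_rows:
  fixes A :: "real mat"
  assumes A: "A \<in> carrier_mat n m" and i: "i < n" and pq: "p < m" "q < m"
    and x: "x i = 0" "\<And>k. k < n - 1 \<Longrightarrow> x (insert_index i k) = z k"
  shows "(transpose_mat (submatrix A (- {i}) UNIV) * mat_diag (n - 1) z * submatrix A (- {i}) UNIV) $$ (p, q)
    = (transpose_mat A * mat_diag n x * A) $$ (p, q)"
  by (subst (1 2) gram_diag_entry[of _ _ m])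
     (use assms in \<open>auto simp: sum_insert_index[OF i] submatrix_rows\<close>)

lemma gram_append_row:
  fixes A B :: "real mat"
  assumes A: "A \<in> carrier_mat n m" and B: "B \<in> carrier_mat k m" and j: "j < n" and pq: "p < m" "q < m"
  shows "(transpose_mat (submatrix A {j} UNIV @\<^sub>r B) * (submatrix A {j} UNIV @\<^sub>r B)) $$ (p, q) =
    A $$ (j, p) * A $$ (j, q) + (transpose_mat B * B) $$ (p, q)"
proof -
  let ?R = "submatrix A {j} UNIV @\<^sub>r B"
  have R: "?R \<in> carrier_mat (Suc k) m"
    using carrier_append_rows[of "submatrix A {j} UNIV" 1 m B k] B submatrix_single_row[OF A j] by simp
  have e: "?R $$ (0, c) = A $$ (j, c)" "\<And>r. r < k \<Longrightarrow> ?R $$ (Suc r, c) = B $$ (r, c)" if "c < m" for c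
    using that B by (auto simp: append_rows_def submatrix_single_row[OF A j])
  have "(transpose_mat ?R * ?R) $$ (p, q) = (\<Sum>r<Suc k. ?R $$ (r, p) * ?R $$ (r, q))"
    using R pq by (simp add: scalar_prod_def atLeast0LessThan del: sum.lessThan_Suc)
  also have "\<dots> = A $$ (j, p) * A $$ (j, q) + (\<Sum>r<k. B $$ (r, p) * B $$ (r, q))"
    \<comment> \<open>Row 0 of the stacked matrix is the row taken from \<open>A\<close>; the
      remaining rows are those of \<open>B\<close>.\<close>
    unfolding sum.lessThan_Suc_shift using pq by (simp add: e)
  also have "(\<Sum>r<k. B $$ (r, p) * B $$ (r, q)) = (transpose_mat B * B) $$ (p, q)"
    using B pq by (simp add: scalar_prod_def atLeast0LessThan)
  finally show ?thesis .
qed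

section \<open>From determinants to logarithmic bounds\<close>

lemma ldet_scaled_mono:
  assumes "0 < c" "0 < c'" "c * det M \<le> c' * det M'"
  shows "ldet M + ereal (ln c) \<le> ldet M' + ereal (ln c')"
\<comment> \<open>If \<open>det M\<close> is not positive, the left side is minus infinity.
  Otherwise positivity passes to \<open>det M'\<close> and logarithms can be taken.\<close>
proof (cases "det M > 0")
  case True
  then have "0 < c' * det M'" using assms by (smt (verit) mult_pos_pos)
  then have M': "det M' > 0" using assms(2) by (simp add: zero_less_mult_iff)
  have "ln (c * det M) \<le> ln (c' * det M')"
    using True M' assms by (subst ln_le_cancel_iff) auto
  then show ?thesis using True M' assms by (simp add: ldet_def ln_mult)
qed (simp add: ldet_def)

text \<open>The left maximum is attained, so comparing at the maximizer avoids moving the constants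
  through a supremum.\<close>

lemma natural_bound_le:
  assumes A: "A \<in> carrier_mat k m" "B \<in> carrier_mat p m" and t: "t \<le> k" and k: "dim_row A' = k"
    and le: "\<And>x. x \<in> nat_feasible k t \<Longrightarrow> nat_objective A B x + c \<le> nat_objective A' B' x + c'"
  shows "natural_bound A B t + c \<le> natural_bound A' B' t + c'"
proof -
  obtain x where x: "x \<in> nat_feasible k t" "natural_bound A B t = nat_objective A B x"
    using natural_bound_attained[OF A t] by blast
  have "nat_objective A' B' x \<le> natural_bound A' B' t"
    unfolding natural_bound_def k using x(1) by (rule SUP_upper)
  then show ?thesis using le[OF x(1)] x(2) by (metis add_right_mono order_trans)
qed

lemma nat_objective_eq_pencil_det:
  assumes rs: "real_schur n C \<Phi> \<Lambda>" and psd: "psd_fun n (\<lambda>k l. C $$ (k, l))"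
    and lam: "lam = lambda_max C" "0 < lam"
    and A: "A = \<Phi> * diag_sqrt (1\<^sub>m n - (1 / lam) \<cdot>\<^sub>m \<Lambda>)"
    and B: "B = (1 / sqrt lam) \<cdot>\<^sub>m diag_sqrt \<Lambda>"
  shows "A \<in> carrier_mat n n" "B \<in> carrier_mat n n"
    "det (transpose_mat A * mat_diag n x * A + transpose_mat B * B) =
      pencil_det n x (\<lambda>k. (1 - x k) / lam) (\<lambda>k l. C $$ (k, l))"
proof -
  have "\<Phi> \<in> carrier_mat n n" "\<Lambda> \<in> carrier_mat n n" using rs by (auto simp: real_schur_def)
  then show "A \<in> carrier_mat n n" "B \<in> carrier_mat n n"
    by (auto simp: A B diag_sqrt_def)
  show "det (transpose_mat A * mat_diag n x * A + transpose_mat B * B) =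
      pencil_det n x (\<lambda>k. (1 - x k) / lam) (\<lambda>k l. C $$ (k, l))"
    by (rule det_gram_eq_pencil_det[OF rs lam(2) _ _ A B])
       (auto simp: lam(1) real_schur_diag_nonneg[OF rs psd] real_schur_diag_le[OF rs])
qed

text \<open>The weights 1 - x add up to \<open>s\<close> because x adds up to \<open>n - s\<close>,
  and the diagonal of \<open>C\<close> is bounded by its greatest eigenvalue. So the scale may be
  raised to \<open>mu\<close>.\<close>

lemma nat_objective_scaled_le:
  assumes rs: "real_schur n C \<Phi> \<Lambda>" and psd: "psd_fun n (\<lambda>k l. C $$ (k, l))"
    and lam: "0 < lambda_max C" "lambda_max C \<le> mu"
    and A: "A = \<Phi> * diag_sqrt (1\<^sub>m n - (1 / lambda_max C) \<cdot>\<^sub>m \<Lambda>)"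
    and B: "B = (1 / sqrt (lambda_max C)) \<cdot>\<^sub>m diag_sqrt \<Lambda>"
    and s: "s \<le> n" and x: "x \<in> nat_feasible n (n - s)"
  shows "lambda_max C ^ s *
      det (transpose_mat A * mat_diag (dim_row A) (\<lambda>k. x $ k) * A + transpose_mat B * B)
    \<le> mu ^ s * pencil_det n (\<lambda>k. x $ k) (\<lambda>k. (1 - x $ k) / mu) (\<lambda>k l. C $$ (k, l))"
proof -
  have d: "dim_row A = n"
    using nat_objective_eq_pencil_det(1)[OF rs psd refl lam(1) A B] by simp
  have "(\<Sum>k<n. 1 - x $ k) = real s"
    using x s by (simp add: nat_feasible_def sum_subtractf of_nat_diff)
  then have "lambda_max C ^ s * pencil_det n (\<lambda>k. 1 - (1 - x $ k)) (\<lambda>k. (1 - x $ k) / lambda_max C) (\<lambda>k l. C $$ (k, l))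
    \<le> mu ^ s * pencil_det n (\<lambda>k. 1 - (1 - x $ k)) (\<lambda>k. (1 - x $ k) / mu) (\<lambda>k l. C $$ (k, l))"
    using x by (intro pencil_det_scaled_mono[OF psd lam diag_le_lambda_max[OF rs]])
      (auto simp: nat_feasible_def)
  then show ?thesis
    unfolding d nat_objective_eq_pencil_det(3)[OF rs psd refl lam(1) A B] by simp
qed

text \<open>Extending a relaxed solution by \<open>x\<^sub>i = 0\<close> (the row is discarded) gives the Schur complement,
  extending it by \<open>x\<^sub>j = 1\<close> (the row is moved to \<open>B\<close>) gives the principal submatrix.\<close>

lemma pencil_det_fix_zero:
  assumes psd: "psd_fun n G" and i: "i < n" and x: "x i = 0"
  shows "pencil_det n x (\<lambda>k. (1 - x k) / lam) G = G i i / lam *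
    pencil_det (n - 1) (\<lambda>k. x (insert_index i k)) (\<lambda>k. (1 - x (insert_index i k)) / lam)
      (\<lambda>k l. schur_fun G i (insert_index i k) (insert_index i l))"
  using pencil_det_pivot[OF i, of G x "\<lambda>k. (1 - x k) / lam"] psd_fun_zero_row[OF psd i] x
  unfolding pencil_det_delete[OF i] by simp

lemma pencil_det_fix_one:
  assumes j: "j < n" and x: "x j = 1"
  shows "pencil_det n x (\<lambda>k. (1 - x k) / lam) G =
    pencil_det (n - 1) (\<lambda>k. x (insert_index j k)) (\<lambda>k. (1 - x (insert_index j k)) / lam)
      (\<lambda>k l. G (insert_index j k) (insert_index j l))"
proof -
  have "pencil_det n x (\<lambda>k. (1 - x k) / lam) G =
      pencil_det n (x(j := 1)) ((\<lambda>k. (1 - x k) / lam)(j := 0)) G"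
    by (rule pencil_det_cong) (use x in auto)
  then show ?thesis unfolding pencil_det_delete[OF j] .
qed

lemma gram_discard_row:
  fixes A B :: "real mat"
  assumes A: "A \<in> carrier_mat n m" and B: "B \<in> carrier_mat p m" and i: "i < n"
    and x: "x i = 0" "\<And>k. k < n - 1 \<Longrightarrow> x (insert_index i k) = z k"
  shows "transpose_mat (submatrix A (- {i}) UNIV) * mat_diag (n - 1) z * submatrix A (- {i}) UNIV +
      transpose_mat B * B = transpose_mat A * mat_diag n x * A + transpose_mat B * B"
proof (rule arg_cong2[where f = "(+)"], rule eq_matI)
  fix p q assume "p < dim_row (transpose_mat A * mat_diag n x * A)"
    "q < dim_col (transpose_mat A * mat_diag n x * A)"
  then have "p < m" "q < m" using A by auto
  then show "(transpose_mat (submatrix A (- {i}) UNIV) * mat_diag (n - 1) z *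
      submatrix A (- {i}) UNIV) $$ (p, q) = (transpose_mat A * mat_diag n x * A) $$ (p, q)"
    by (rule gram_submatrix_rows[OF A i _ _ x])
qed (use A i in \<open>auto simp: submatrix_rows\<close>)

lemma gram_move_row:
  fixes A B :: "real mat"
  assumes A: "A \<in> carrier_mat n m" and B: "B \<in> carrier_mat p m" and j: "j < n"
    and x: "x j = 1" "\<And>k. k < n - 1 \<Longrightarrow> x (insert_index j k) = z k"
  shows "transpose_mat (submatrix A (- {j}) UNIV) * mat_diag (n - 1) z * submatrix A (- {j}) UNIV +
      transpose_mat (submatrix A {j} UNIV @\<^sub>r B) * (submatrix A {j} UNIV @\<^sub>r B) =
    transpose_mat A * mat_diag n x * A + transpose_mat B * B" (is "?L + ?R = ?M")
proof (rule eq_matI)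
  have R: "submatrix A {j} UNIV @\<^sub>r B \<in> carrier_mat (1 + p) m"
    by (rule carrier_append_rows[OF _ B]) (simp add: submatrix_single_row[OF A j])
  have L: "?L \<in> carrier_mat m m" by (rule carrier_matI) (simp_all add: submatrix_rows[OF A j])
  fix q r assume "q < dim_row ?M" "r < dim_col ?M"
  then have qr: "q < m" "r < m" using A B by auto
  have "(?L + ?R) $$ (q, r) = ?L $$ (q, r) + ?R $$ (q, r)"
    using L R qr by simp
  also have "\<dots> = (transpose_mat A * mat_diag n (x(j := 0)) * A) $$ (q, r) +
      (A $$ (j, q) * A $$ (j, r) + (transpose_mat B * B) $$ (q, r))"
    using gram_submatrix_rows[OF A j qr, of "x(j := 0)" z] x(2)
    by (simp add: gram_append_row[OF A B j qr])
  \<comment> \<open>Row \<open>j\<close>, taken out with weight 0, returns with weight 1 through its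
    copy on top of \<open>B\<close>.\<close>
  also have "(transpose_mat A * mat_diag n (x(j := 0)) * A) $$ (q, r) + A $$ (j, q) * A $$ (j, r) =
      (transpose_mat A * mat_diag n x * A) $$ (q, r)"
    unfolding gram_diag_entry[OF A qr] sum_insert_index[OF j] by (simp add: x(1))
  then have "(transpose_mat A * mat_diag n (x(j := 0)) * A) $$ (q, r) +
      (A $$ (j, q) * A $$ (j, r) + (transpose_mat B * B) $$ (q, r)) = ?M $$ (q, r)"
    using A B qr by simp
  finally show "(?L + ?R) $$ (q, r) = ?M $$ (q, r)" .
next
  have R: "submatrix A {j} UNIV @\<^sub>r B \<in> carrier_mat (1 + p) m"
    by (rule carrier_append_rows[OF _ B]) (simp add: submatrix_single_row[OF A j])
  then show "dim_row (?L + ?R) = dim_row ?M" "dim_col (?L + ?R) = dim_col ?M"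
    using A B by auto
qed

section \<open>Comparison of the natural bounds\<close>

lemma rank_pos_imp_nonzero:
  assumes "0 < vec_space.rank n (C :: real mat)"
  shows "C \<noteq> 0\<^sub>m n m"
  using assms vec_space.rank_0I[of n m] by (metis less_irrefl)

text \<open>A vanishing Schur complement would make \<open>C\<close> the outer product of column
  \<open>i\<close> and the scaled row \<open>i\<close>, hence of rank at most 1.\<close>

lemma schur_compl_nonzero:
  fixes C :: "real mat"
  assumes C: "C \<in> carrier_mat n n" and i: "i < n" and pos: "C $$ (i, i) > 0"
    and rank: "2 \<le> vec_space.rank n C"
  shows "schur_compl C i \<noteq> 0\<^sub>m (n - 1) (n - 1)"
proof
  assume z: "schur_compl C i = 0\<^sub>m (n - 1) (n - 1)"
  let ?S = "schur_fun (\<lambda>k l. C $$ (k, l)) i"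
  have S0: "?S (insert_index i k) (insert_index i l) = 0" if "k < n - 1" "l < n - 1" for k l
    using arg_cong[OF z, of "\<lambda>M. M $$ (k, l)"] that by (simp add: schur_compl_entries[OF C i])
  have "C $$ (k, l) = C $$ (k, i) * (C $$ (i, l) / C $$ (i, i))" if kl: "k < n" "l < n" for k l
  proof (cases "k = i \<or> l = i")
    case False
    then have "k = insert_index i (delete_index i k)" "delete_index i k < n - 1"
      "l = insert_index i (delete_index i l)" "delete_index i l < n - 1"
      using kl i by (auto simp: insert_index_def delete_index_def)
    then have "?S k l = 0" using S0 by metis
    then show ?thesis by (simp add: schur_fun_def)
  qed (use pos in auto)
  then have "vec_space.rank n C \<le> 1"
    using C by (intro vec_space.rank_le_1_product_entries[OF C, of "\<lambda>k. C $$ (k, i)"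
        "\<lambda>l. C $$ (i, l) / C $$ (i, i)"]) auto
  then show False using rank by simp
qed

lemma mesp_to_dopt_eqD:
  assumes "DOpt A B t = mesp_to_dopt (MESP C s) \<Phi> \<Lambda>" and "dim_row C = n"
  shows "A = \<Phi> * diag_sqrt (1\<^sub>m n - (1 / lambda_max C) \<cdot>\<^sub>m \<Lambda>)"
    and "B = (1 / sqrt (lambda_max C)) \<cdot>\<^sub>m diag_sqrt \<Lambda>"
  using assms by auto

text \<open>Zero padding bounds the greatest eigenvalue of \<open>C0\<close> by \<open>lam\<close>,
  so the scale of its objective can be raised to \<open>lam\<close>. Extending x by 1 at
  \<open>j\<close> then turns the determinant into the objective on the right.\<close>

lemma submatrix_bound:
  fixes C :: "real mat"
  assumes rs: "real_schur n C \<Phi> \<Lambda>" and psd: "psd_fun n (\<lambda>k l. C $$ (k, l))"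
    and lam: "lam = lambda_max C" "0 < lam"
    and A: "A = \<Phi> * diag_sqrt (1\<^sub>m n - (1 / lam) \<cdot>\<^sub>m \<Lambda>)"
    and B: "B = (1 / sqrt lam) \<cdot>\<^sub>m diag_sqrt \<Lambda>"
    and j: "j < n" and C0: "C0 = submatrix C (- {j}) (- {j})" and s: "0 < s" "s \<le> n - 1"
    and rank: "s \<le> vec_space.rank (n - 1) C0"
    and rs0: "real_schur (n - 1) C0 \<Phi>0 \<Lambda>0"
    and A0: "DOpt A0 B0 (n - 1 - s) = mesp_to_dopt (MESP C0 s) \<Phi>0 \<Lambda>0"
  shows "natural_bound A0 B0 (n - 1 - s) + ereal (real s * ln (lambda_max C0))
    \<le> natural_bound (submatrix A (- {j}) UNIV) (submatrix A {j} UNIV @\<^sub>r B) (n - s - 1)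
      + ereal (real s * ln lam)"
proof -
  note C = real_schur_carrier(3)[OF rs] and C0c = real_schur_carrier(3)[OF rs0]
  note obj = nat_objective_eq_pencil_det[OF rs psd lam A B]
  have C0e: "C0 $$ (k, l) = C $$ (insert_index j k, insert_index j l)" if "k < n - 1" "l < n - 1" for k l
    using that by (simp add: C0 submatrix_delete[OF C j])
  have psd0: "psd_fun (n - 1) (\<lambda>k l. C0 $$ (k, l))"
    using psd_fun_delete[OF psd j] by (subst psd_fun_cong[OF C0e])
  have pos0: "0 < lambda_max C0"
    by (rule lambda_max_pos[OF rs0 psd0]) (use rank s rank_pos_imp_nonzero in auto)
  have le0: "lambda_max C0 \<le> lam"
  proof (rule lambda_max_le[OF rs0])
    fix v :: "nat \<Rightarrow> real"
    have "quad_form (n - 1) (\<lambda>k l. C0 $$ (k, l)) v =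
        quad_form n (\<lambda>k l. C $$ (k, l)) (\<lambda>k. if k = j then 0 else v (delete_index j k))"
      by (subst quad_form_cong[OF C0e]) (auto simp: quad_form_delete[OF j, of "\<lambda>k l. C $$ (k, l)"] simp del: One_nat_def)
    also have "\<dots> \<le> lam * (\<Sum>k<n - 1. (v k)\<^sup>2)"
      using quad_form_le_lambda_max[OF rs, of "\<lambda>k. if k = j then 0 else v (delete_index j k)"]
      unfolding sum_squares_delete[OF j] lam(1) .
    finally show "quad_form (n - 1) (\<lambda>k l. C0 $$ (k, l)) v \<le> lam * (\<Sum>k<n - 1. (v k)\<^sup>2)" .
  qed (use s in auto)
  have dim0: "dim_row C0 = n - 1" using C0c by simp
  note AB0 = mesp_to_dopt_eqD[OF A0 dim0]
  note obj0 = nat_objective_eq_pencil_det[OF rs0 psd0 refl pos0 AB0]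
  let ?A = "submatrix A (- {j}) UNIV" and ?B = "submatrix A {j} UNIV @\<^sub>r B"
  have dA: "dim_row ?A = n - 1" using submatrix_rows[OF obj(1) j] by simp
  have "natural_bound A0 B0 (n - 1 - s) + ereal (real s * ln (lambda_max C0))
    \<le> natural_bound ?A ?B (n - 1 - s) + ereal (real s * ln lam)"
  proof (rule natural_bound_le[OF obj0(1,2) _ dA])
    fix x assume x: "x \<in> nat_feasible (n - 1) (n - 1 - s)"
    let ?x = "\<lambda>k. if k = j then 1 else x $ delete_index j k"
    have "lambda_max C0 ^ s *
        det (transpose_mat A0 * mat_diag (dim_row A0) (\<lambda>k. x $ k) * A0 + transpose_mat B0 * B0)
      \<le> lam ^ s * pencil_det (n - 1) (\<lambda>k. x $ k) (\<lambda>k. (1 - x $ k) / lam) (\<lambda>k l. C0 $$ (k, l))"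
      by (rule nat_objective_scaled_le[OF rs0 psd0 pos0 le0 AB0 s(2) x])
    also have "pencil_det (n - 1) (\<lambda>k. x $ k) (\<lambda>k. (1 - x $ k) / lam) (\<lambda>k l. C0 $$ (k, l)) =
        pencil_det n ?x (\<lambda>k. (1 - ?x k) / lam) (\<lambda>k l. C $$ (k, l))"
      by (subst pencil_det_fix_one[OF j]) (auto intro!: pencil_det_cong simp: C0e)
    also have "\<dots> = det (transpose_mat ?A * mat_diag (dim_row ?A) (\<lambda>k. x $ k) * ?A + transpose_mat ?B * ?B)"
    proof -
      have "transpose_mat ?A * mat_diag (n - 1) (\<lambda>k. x $ k) * ?A + transpose_mat ?B * ?B =
          transpose_mat A * mat_diag n ?x * A + transpose_mat B * B"
        by (rule gram_move_row[OF obj(1,2) j]) auto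
      then show ?thesis unfolding dA by (simp only: obj(3))
    qed
    finally show "nat_objective A0 B0 x + ereal (real s * ln (lambda_max C0))
        \<le> nat_objective ?A ?B x + ereal (real s * ln lam)"
      unfolding nat_objective_def using pos0 lam(2)
      by (simp add: ldet_scaled_mono flip: ln_realpow)
  qed (use s in auto)
  then show ?thesis by (simp add: diff_commute)
qed

text \<open>Extending x by 0 at \<open>i\<close> splits off the factor
  \<open>C $$ (i, i) / lam\<close>. Its numerator gives the extra logarithm on the left; its
  denominator accounts for the power \<open>s\<close> of \<open>lam\<close> against
  \<open>s - 1\<close> in the reduced problem.\<close>

lemma schur_compl_bound:
  fixes C :: "real mat"
  assumes rs: "real_schur n C \<Phi> \<Lambda>" and psd: "psd_fun n (\<lambda>k l. C $$ (k, l))"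
    and lam: "lam = lambda_max C" "0 < lam"
    and A: "A = \<Phi> * diag_sqrt (1\<^sub>m n - (1 / lam) \<cdot>\<^sub>m \<Lambda>)"
    and B: "B = (1 / sqrt lam) \<cdot>\<^sub>m diag_sqrt \<Lambda>"
    and i: "i < n" and Cii: "C $$ (i, i) > 0" and C1: "C1 = schur_compl C i" and s: "2 \<le> s" "s \<le> n"
    and rank: "s \<le> vec_space.rank n C"
    and rs1: "real_schur (n - 1) C1 \<Phi>1 \<Lambda>1"
    and A1: "DOpt A1 B1 (n - s) = mesp_to_dopt (MESP C1 (s - 1)) \<Phi>1 \<Lambda>1"
  shows "natural_bound A1 B1 (n - s) + ereal ((real s - 1) * ln (lambda_max C1)) + ereal (ln (C $$ (i, i)))
    \<le> natural_bound (submatrix A (- {i}) UNIV) B (n - s) + ereal (real s * ln lam)"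
proof -
  note C = real_schur_carrier(3)[OF rs] and C1c = real_schur_carrier(3)[OF rs1]
  note obj = nat_objective_eq_pencil_det[OF rs psd lam A B]
  let ?S = "schur_fun (\<lambda>k l. C $$ (k, l)) i"
  have C1e: "C1 $$ (k, l) = ?S (insert_index i k) (insert_index i l)" if "k < n - 1" "l < n - 1" for k l
    using that by (simp add: C1 schur_compl_entries[OF C i])
  have psd1: "psd_fun (n - 1) (\<lambda>k l. C1 $$ (k, l))"
    using psd_fun_delete[OF psd_fun_schur[OF psd i] i] by (subst psd_fun_cong[OF C1e])
  have pos1: "0 < lambda_max C1"
    by (rule lambda_max_pos[OF rs1 psd1])
       (use schur_compl_nonzero[OF C i Cii] rank s C1 in auto)
  \<comment> \<open>On zero-padded vectors the form of the Schur complement lies below that of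
    \<open>C\<close>.\<close>
  have le1: "lambda_max C1 \<le> lam"
  proof (rule lambda_max_le[OF rs1])
    fix v :: "nat \<Rightarrow> real"
    let ?v = "\<lambda>k. if k = i then 0 else v (delete_index i k)"
    have "quad_form (n - 1) (\<lambda>k l. C1 $$ (k, l)) v = quad_form n ?S ?v"
      by (subst quad_form_cong[OF C1e]) (auto simp: quad_form_delete[OF i, of ?S] simp del: One_nat_def)
    also have "\<dots> \<le> quad_form n (\<lambda>k l. C $$ (k, l)) ?v"
      by (rule quad_form_schur_le[OF psd i])
    also have "\<dots> \<le> lam * (\<Sum>k<n - 1. (v k)\<^sup>2)"
      using quad_form_le_lambda_max[OF rs, of ?v]
      unfolding sum_squares_delete[OF i] lam(1) .
    finally show "quad_form (n - 1) (\<lambda>k l. C1 $$ (k, l)) v \<le> lam * (\<Sum>k<n - 1. (v k)\<^sup>2)" .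
  qed (use s in auto)
  have dim1: "dim_row C1 = n - 1" using C1c by simp
  note AB1 = mesp_to_dopt_eqD[OF A1 dim1]
  note obj1 = nat_objective_eq_pencil_det[OF rs1 psd1 refl pos1 AB1]
  let ?A = "submatrix A (- {i}) UNIV"
  have dA: "dim_row ?A = n - 1" using submatrix_rows[OF obj(1) i] by simp
  \<comment> \<open>Size and subset cardinality both drop by one, so the sum constraint
    \<open>n - s\<close> is already that of the reduced problem.\<close>
  have ns: "n - s = n - 1 - (s - 1)" and s1: "s - 1 \<le> n - 1" using s by auto
  \<comment> \<open>The constants on the left are gathered into one logarithm for the determinant
    comparison and split again afterwards.\<close>
  have "natural_bound A1 B1 (n - s) + ereal (ln (lambda_max C1 ^ (s - 1) * C $$ (i, i)))
    \<le> natural_bound ?A B (n - s) + ereal (ln (lam ^ s))"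
  proof (rule natural_bound_le[OF obj1(1,2) _ dA])
    fix x assume x: "x \<in> nat_feasible (n - 1) (n - s)"
    let ?x = "\<lambda>k. if k = i then 0 else x $ delete_index i k"
    let ?P = "pencil_det (n - 1) (\<lambda>k. x $ k) (\<lambda>k. (1 - x $ k) / lam) (\<lambda>k l. C1 $$ (k, l))"
    let ?L = "det (transpose_mat A1 * mat_diag (dim_row A1) (\<lambda>k. x $ k) * A1 + transpose_mat B1 * B1)"
    have "lambda_max C1 ^ (s - 1) * ?L \<le> lam ^ (s - 1) * ?P"
      using x unfolding ns by (rule nat_objective_scaled_le[OF rs1 psd1 pos1 le1 AB1 s1])
    then have "lambda_max C1 ^ (s - 1) * C $$ (i, i) * ?L \<le> lam ^ (s - 1) * C $$ (i, i) * ?P"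
      using mult_right_mono[of _ _ "C $$ (i, i)"] Cii by (simp add: mult_ac)
    also have "lam ^ (s - 1) * C $$ (i, i) * ?P = lam ^ s * (C $$ (i, i) / lam * ?P)"
      using lam(2) s by (cases s) auto
    also have "C $$ (i, i) / lam * ?P = pencil_det n ?x (\<lambda>k. (1 - ?x k) / lam) (\<lambda>k l. C $$ (k, l))"
      by (subst pencil_det_fix_zero[OF psd i])
         (auto intro!: pencil_det_cong arg_cong2[where f = "(*)"] simp: C1e)
    also have "\<dots> = det (transpose_mat ?A * mat_diag (dim_row ?A) (\<lambda>k. x $ k) * ?A + transpose_mat B * B)"
    proof -
      have "transpose_mat ?A * mat_diag (n - 1) (\<lambda>k. x $ k) * ?A + transpose_mat B * B =
          transpose_mat A * mat_diag n ?x * A + transpose_mat B * B"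
        by (rule gram_discard_row[OF obj(1,2) i]) auto
      then show ?thesis unfolding dA by (simp only: obj(3))
    qed
    finally show "nat_objective A1 B1 x + ereal (ln (lambda_max C1 ^ (s - 1) * C $$ (i, i)))
        \<le> nat_objective ?A B x + ereal (ln (lam ^ s))"
      unfolding nat_objective_def using pos1 lam(2) Cii by (intro ldet_scaled_mono) auto
  qed (use s in auto)
  moreover have "ln (lambda_max C1 ^ (s - 1) * C $$ (i, i)) = (real s - 1) * ln (lambda_max C1) + ln (C $$ (i, i))"
    using pos1 Cii s by (simp add: ln_mult ln_realpow of_nat_diff)
  ultimately show ?thesis
    using lam(2) by (simp add: ln_realpow add.assoc)
qed

theorem theorem40:
  fixes C \<Phi> \<Lambda> A B :: "real mat" and n s :: nat and lmax :: real
  assumes "mesp_valid n (MESP C s)"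
    and "lmax = lambda_max C"
    and "real_schur n C \<Phi> \<Lambda>"
    and "A = \<Phi> * diag_sqrt (1\<^sub>m n - (1 / lmax) \<cdot>\<^sub>m \<Lambda>)"
    and "B = (1 / sqrt lmax) \<cdot>\<^sub>m diag_sqrt \<Lambda>"
  shows
    "DOpt A B (n - s) = mesp_to_dopt (MESP C s) \<Phi> \<Lambda> \<and>
     (\<forall>i \<Phi>1 \<Lambda>1 A1 B1.
        i < n \<and> C $$ (i, i) > 0 \<and> s \<ge> 2 \<and>
        real_schur (n - 1) (schur_compl C i) \<Phi>1 \<Lambda>1 \<and>
        DOpt A1 B1 (n - s) = mesp_to_dopt (MESP (schur_compl C i) (s - 1)) \<Phi>1 \<Lambda>1 \<longrightarrow>
        natural_bound A1 B1 (n - s) + ereal ((real s - 1) * ln (lambda_max (schur_compl C i)))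
            + ereal (ln (C $$ (i, i)))
          \<le> natural_bound (submatrix A (- {i}) UNIV) B (n - s) + ereal (real s * ln lmax)) \<and>
     (\<forall>j \<Phi>0 \<Lambda>0 A0 B0.
        j < n \<and> s \<le> n - 2 \<and> s \<le> vec_space.rank (n - 1) (submatrix C (- {j}) (- {j})) \<and>
        real_schur (n - 1) (submatrix C (- {j}) (- {j})) \<Phi>0 \<Lambda>0 \<and>
        DOpt A0 B0 (n - 1 - s) = mesp_to_dopt (MESP (submatrix C (- {j}) (- {j})) s) \<Phi>0 \<Lambda>0 \<longrightarrow>
        natural_bound A0 B0 (n - 1 - s)
            + ereal (real s * ln (lambda_max (submatrix C (- {j}) (- {j}))))
          \<le> natural_bound (submatrix A (- {j}) UNIV) (submatrix A {j} UNIV @\<^sub>r B) (n - s - 1)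
            + ereal (real s * ln lmax))"
proof -
  have psd: "psd n C" and s: "0 < s" "s < n" "s \<le> vec_space.rank n C" using assms(1) by auto
  note rs = assms(3) and pf = psd_imp_psd_fun[OF psd]
  have d: "dim_row C = n" using psd by (auto simp: psd_def)
  \<comment> \<open>Positive rank excludes the zero matrix, so the scalings by \<open>lmax\<close>
    are by a positive number.\<close>
  have pos: "0 < lmax"
    unfolding assms(2) by (rule lambda_max_pos[OF rs pf]) (use s rank_pos_imp_nonzero in auto)
  show ?thesis
  proof (intro conjI allI impI; (elim conjE)?)
    show "DOpt A B (n - s) = mesp_to_dopt (MESP C s) \<Phi> \<Lambda>"
      using assms d by simp
  next
    fix i \<Phi>1 \<Lambda>1 A1 B1
    assume "i < n" "C $$ (i, i) > 0" "s \<ge> 2" "real_schur (n - 1) (schur_compl C i) \<Phi>1 \<Lambda>1"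
      "DOpt A1 B1 (n - s) = mesp_to_dopt (MESP (schur_compl C i) (s - 1)) \<Phi>1 \<Lambda>1"
    then show "natural_bound A1 B1 (n - s) + ereal ((real s - 1) * ln (lambda_max (schur_compl C i)))
          + ereal (ln (C $$ (i, i)))
        \<le> natural_bound (submatrix A (- {i}) UNIV) B (n - s) + ereal (real s * ln lmax)"
      using s by (intro schur_compl_bound[OF rs pf assms(2) pos assms(4,5) _ _ refl]) auto
  next
    fix j \<Phi>0 \<Lambda>0 A0 B0
    assume "j < n" "s \<le> n - 2" "s \<le> vec_space.rank (n - 1) (submatrix C (- {j}) (- {j}))"
      "real_schur (n - 1) (submatrix C (- {j}) (- {j})) \<Phi>0 \<Lambda>0"
      "DOpt A0 B0 (n - 1 - s) = mesp_to_dopt (MESP (submatrix C (- {j}) (- {j})) s) \<Phi>0 \<Lambda>0"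
    then show "natural_bound A0 B0 (n - 1 - s)
          + ereal (real s * ln (lambda_max (submatrix C (- {j}) (- {j}))))
        \<le> natural_bound (submatrix A (- {j}) UNIV) (submatrix A {j} UNIV @\<^sub>r B) (n - s - 1)
          + ereal (real s * ln lmax)"
      using s by (intro submatrix_bound[OF rs pf assms(2) pos assms(4,5) _ refl]) auto
  qed
qed

end
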